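(* The isometry class $\widehat{D2P}_{\mathcal{B}}=\{\mu\in\mathcal{B}: X_\mu$ has the diameter two property$\}$ is $G_\delta$-complete in $\mathcal{B}$.
   Context: $V$ is the set of finitely supported rational sequences; $\mathcal{P}\subset\mathbb{R}^V$ the seminorms on $V$ with pointwise convergence topology; for $\mu\in\mathcal{P}$, $\bar\mu$ is its seminorm extension to $c_{00}$ and $X_\mu$ the completion of $c_{00}/\{\bar\mu=0\}$; $\mathcal{B}$ is the set of $\mu\in\mathcal{P}$ with $X_\mu$ infinite-dimensional and $\bar\mu$ a norm on $c_{00}$, with the subspace topology (a Polish space). A Banach space $X$ has the diameter two property (D2P) if every nonempty relatively weakly open subset of $B_X$ has diameter 2. A subset $A$ of a Polish space $Z$ is $G_\delta$-complete if it is $G_\delta$ and for every zero-dimensional Polish space $Y$ and $G_\delta$ set $B\subset Y$ there is a continuous $f:Y\to Z$ with $B=f^{-1}(A)$. *)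

theory Defs
  imports "HOL-Analysis.Analysis" "HOL-Library.Poly_Mapping"
begin

record 'a nspace =
  ns_carrier :: "'a set"
  ns_zero :: 'a
  ns_add :: "'a \<Rightarrow> 'a \<Rightarrow> 'a"
  ns_scale :: "real \<Rightarrow> 'a \<Rightarrow> 'a"
  ns_norm :: "'a \<Rightarrow> real"

definition ns_diff :: "'a nspace \<Rightarrow> 'a \<Rightarrow> 'a \<Rightarrow> 'a" where
  "ns_diff X x y = ns_add X x (ns_scale X (-1) y)"

definition ns_dual :: "'a nspace \<Rightarrow> ('a \<Rightarrow> real) set" where
  "ns_dual X = {\<phi>.
     (\<forall>x\<in>ns_carrier X. \<forall>y\<in>ns_carrier X. \<phi> (ns_add X x y) = \<phi> x + \<phi> y) \<and>
     (\<forall>c. \<forall>x\<in>ns_carrier X. \<phi> (ns_scale X c x) = c * \<phi> x) \<and>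
     (\<exists>C. \<forall>x\<in>ns_carrier X. \<bar>\<phi> x\<bar> \<le> C * ns_norm X x)}"

definition ns_weak :: "'a nspace \<Rightarrow> 'a topology" where
  "ns_weak X = subtopology
     (topology_generated_by {{x\<in>ns_carrier X. \<phi> x \<in> U} | \<phi> U. \<phi> \<in> ns_dual X \<and> open U})
     (ns_carrier X)"

definition ns_ball :: "'a nspace \<Rightarrow> 'a set" where
  "ns_ball X = {x\<in>ns_carrier X. ns_norm X x \<le> 1}"

definition ns_diam :: "'a nspace \<Rightarrow> 'a set \<Rightarrow> real" where
  "ns_diam X A = Sup {ns_norm X (ns_diff X x y) | x y. x \<in> A \<and> y \<in> A}"

definition D2P :: "'a nspace \<Rightarrow> bool" where
  "D2P X \<longleftrightarrow> (\<forall>W. openin (subtopology (ns_weak X) (ns_ball X)) W \<and> W \<noteq> {}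
                 \<longrightarrow> ns_diam X W = 2)"

definition ns_lincomb :: "'a nspace \<Rightarrow> real list \<Rightarrow> 'a list \<Rightarrow> 'a" where
  "ns_lincomb X cs xs = foldr (\<lambda>(c,x) acc. ns_add X (ns_scale X c x) acc) (zip cs xs) (ns_zero X)"

definition ns_infdim :: "'a nspace \<Rightarrow> bool" where
  "ns_infdim X \<longleftrightarrow> (\<forall>n. \<exists>xs. length xs = n \<and> distinct xs \<and> set xs \<subseteq> ns_carrier X \<and>
      (\<forall>cs. length cs = n \<and> ns_lincomb X cs xs = ns_zero X \<longrightarrow> (\<forall>c\<in>set cs. c = 0)))"

type_synonym V = "nat \<Rightarrow>\<^sub>0 rat"
type_synonym c00 = "nat \<Rightarrow>\<^sub>0 real"

definition vscale :: "rat \<Rightarrow> V \<Rightarrow> V" where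
  "vscale q v = Poly_Mapping.map (\<lambda>a. q * a) v"

definition cscale :: "real \<Rightarrow> c00 \<Rightarrow> c00" where
  "cscale c x = Poly_Mapping.map (\<lambda>a. c * a) x"

definition embV :: "V \<Rightarrow> c00" where
  "embV v = Poly_Mapping.map of_rat v"

definition seminormsV :: "(V \<Rightarrow> real) set" where
  "seminormsV = {\<mu>. (\<forall>v. 0 \<le> \<mu> v) \<and> (\<forall>q v. \<mu> (vscale q v) = of_rat \<bar>q\<bar> * \<mu> v) \<and>
                     (\<forall>u v. \<mu> (u + v) \<le> \<mu> u + \<mu> v)}"

definition is_seminorm_c00 :: "(c00 \<Rightarrow> real) \<Rightarrow> bool" where
  "is_seminorm_c00 m \<longleftrightarrow> (\<forall>x. 0 \<le> m x) \<and> (\<forall>c x. m (cscale c x) = \<bar>c\<bar> * m x) \<and>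
                          (\<forall>x y. m (x + y) \<le> m x + m y)"

definition mubar :: "(V \<Rightarrow> real) \<Rightarrow> c00 \<Rightarrow> real" where
  "mubar \<mu> = (THE m. is_seminorm_c00 m \<and> (\<forall>v. m (embV v) = \<mu> v))"

text \<open>Completion of c00 / {mubar = 0}, realised as classes of mubar-Cauchy sequences.\<close>
definition csq :: "(V \<Rightarrow> real) \<Rightarrow> (nat \<Rightarrow> c00) set" where
  "csq \<mu> = {s. \<forall>e>0. \<exists>N. \<forall>m\<ge>N. \<forall>n\<ge>N. mubar \<mu> (s m - s n) < e}"

definition ccls :: "(V \<Rightarrow> real) \<Rightarrow> (nat \<Rightarrow> c00) \<Rightarrow> (nat \<Rightarrow> c00) set" where
  "ccls \<mu> s = {t \<in> csq \<mu>. (\<lambda>n. mubar \<mu> (s n - t n)) \<longlonglongrightarrow> 0}"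

definition crep :: "(nat \<Rightarrow> c00) set \<Rightarrow> nat \<Rightarrow> c00" where
  "crep A = (SOME s. s \<in> A)"

definition Xmu :: "(V \<Rightarrow> real) \<Rightarrow> (nat \<Rightarrow> c00) set nspace" where
  "Xmu \<mu> = \<lparr> ns_carrier = {ccls \<mu> s | s. s \<in> csq \<mu>},
             ns_zero = ccls \<mu> (\<lambda>n. 0),
             ns_add = (\<lambda>A B. ccls \<mu> (\<lambda>n. crep A n + crep B n)),
             ns_scale = (\<lambda>c A. ccls \<mu> (\<lambda>n. cscale c (crep A n))),
             ns_norm = (\<lambda>A. lim (\<lambda>n. mubar \<mu> (crep A n))) \<rparr>"

text \<open>The space \<B> (with the subspace topology of the product topology on V \<Rightarrow> real).\<close>
definition codesB :: "(V \<Rightarrow> real) set" where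
  "codesB = {\<mu> \<in> seminormsV. ns_infdim (Xmu \<mu>) \<and> (\<forall>x. mubar \<mu> x = 0 \<longrightarrow> x = 0)}"

definition Btop :: "(V \<Rightarrow> real) topology" where
  "Btop = subtopology euclidean codesB"

definition D2P_class :: "(V \<Rightarrow> real) set" where
  "D2P_class = {\<mu> \<in> codesB. D2P (Xmu \<mu>)}"

definition Polish_space :: "'a topology \<Rightarrow> bool" where
  "Polish_space X \<longleftrightarrow> completely_metrizable_space X \<and> separable_space X"

end

theory Submission
  imports Defs
begin

text \<open>The completion and the weak topology can be removed from the diameter two property: it holds for
  \<open>X\<^sub>\<mu>\<close> iff, for every \<open>x\<^sub>0 \<in> V\<close> with \<open>\<mu> x\<^sub>0 < 1\<close>, all functionals \<open>f\<^sub>1, \<dots>, f\<^sub>n\<close> on \<open>V\<close> dominated by \<open>\<mu>\<close>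
  and every tolerance, there are \<open>x, y \<in> V\<close> in the open unit ball, at distance almost \<open>2\<close>, at which the
  \<open>f\<^sub>i\<close> take almost the same values as at \<open>x\<^sub>0\<close>. For fixed \<open>x\<^sub>0\<close>, \<open>n\<close> and tolerance the set of \<open>\<mu>\<close> for which some
  \<open>f\<^sub>1, \<dots>, f\<^sub>n\<close> violate this is closed, being a projection along a compact space of functionals; as \<open>V\<close>
  is countable, the class is \<open>G\<^sub>\<delta>\<close>.

  For completeness, cut \<open>\<nat>\<close> into blocks at the ones of a binary sequence \<open>a\<close> and take the \<open>c\<^sub>0\<close>-sum of the
  \<open>\<ell>\<^sub>1\<close>-spaces over the blocks. With infinitely many ones this is an infinite \<open>c\<^sub>0\<close>-sum, which has the
  diameter two property; with finitely many ones, the last block is an infinite \<open>\<ell>\<^sub>1\<close> and the other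
  coordinates are finite in number, so the unit ball has weakly open subsets of small diameter. A
  \<open>G\<^sub>\<delta>\<close> subset of a zero-dimensional Polish space is the set of points that lie in infinitely many
  members of a suitable sequence of clopen sets.\<close>

subsection \<open>Seminorms on finitely supported sequences\<close>

abbreviation "lookup \<equiv> Poly_Mapping.lookup"
abbreviation "keys \<equiv> Poly_Mapping.keys"

lemma lookup_cscale [simp]: "lookup (cscale c x) i = c * lookup x i"
  by (simp add: cscale_def Poly_Mapping.map.rep_eq when_def)

lemma lookup_vscale [simp]: "lookup (vscale q v) i = q * lookup v i"
  by (simp add: vscale_def Poly_Mapping.map.rep_eq when_def)

lemma lookup_embV [simp]: "lookup (embV v) i = of_rat (lookup v i)"
  by (simp add: embV_def Poly_Mapping.map.rep_eq when_def)

lemma embV_add: "embV (u + v) = embV u + embV v"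
  by (rule poly_mapping_eqI) (simp add: lookup_add of_rat_add)

lemma embV_diff: "embV (u - v) = embV u - embV v"
  by (rule poly_mapping_eqI) (simp add: lookup_minus of_rat_diff)

lemma embV_vscale: "embV (vscale q v) = cscale (of_rat q) (embV v)"
  by (rule poly_mapping_eqI) (simp add: of_rat_mult)

lemma cscale_diff: "cscale c (x - y) = cscale c x - cscale c y"
  by (rule poly_mapping_eqI) (simp add: lookup_minus algebra_simps)

lemma cscale_minus_one: "cscale (-1) x = - x"
  by (rule poly_mapping_eqI) simp

lemma cscale_zero: "cscale 0 x = 0" "cscale c 0 = 0"
  by (auto intro: poly_mapping_eqI)

lemma vscale_zero: "vscale 0 v = 0"
  by (auto intro: poly_mapping_eqI)

text \<open>Serves to pass from rational to real scalars whenever homogeneity is obtained as a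
  limit.\<close>

lemma rat_sequence_tendsto:
  obtains q where "(\<lambda>n. real_of_rat (q n)) \<longlonglongrightarrow> c"
proof -
  have "\<exists>r. c < real_of_rat r \<and> real_of_rat r < c + 1 / Suc n" for n
    by (rule of_rat_dense) simp
  then obtain q where q: "\<And>n. c < real_of_rat (q n)" "\<And>n. real_of_rat (q n) < c + 1 / Suc n"
    by metis
  have "(\<lambda>n. c + 1 / Suc n) \<longlonglongrightarrow> c + 0"
    by (intro tendsto_add tendsto_const LIMSEQ_Suc lim_1_over_n)
  then have "(\<lambda>n. real_of_rat (q n)) \<longlonglongrightarrow> c"
    by (intro real_tendsto_sandwich[of "\<lambda>_. c" "\<lambda>n. real_of_rat (q n)" sequentially "\<lambda>n. c + 1 / Suc n"])
       (use q in \<open>auto intro!: always_eventually less_imp_le simp del: of_nat_Suc\<close>)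
  with that show thesis .
qed

lemma poly_mapping_sum_single:
  fixes x :: "'a \<Rightarrow>\<^sub>0 'b::comm_monoid_add"
  shows "(\<Sum>i\<in>keys x. Poly_Mapping.single i (lookup x i)) = x"
proof (rule poly_mapping_eqI)
  fix k
  show "lookup (\<Sum>i\<in>keys x. Poly_Mapping.single i (lookup x i)) k = lookup x k"
    by (cases "k \<in> keys x") (auto simp: lookup_sum lookup_single when_def sum.delta' in_keys_iff)
qed

locale c00_seminorm =
  fixes m :: "c00 \<Rightarrow> real"
  assumes seminorm: "is_seminorm_c00 m"
begin

lemma nonneg [simp]: "0 \<le> m x"
  and scale: "m (cscale c x) = \<bar>c\<bar> * m x"
  and triangle: "m (x + y) \<le> m x + m y"
  using seminorm by (auto simp: is_seminorm_c00_def)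

lemma zero [simp]: "m 0 = 0"
  using scale[of 0 0] by (simp add: cscale_zero)

lemma uminus: "m (- x) = m x"
  using scale[of "-1" x] by (simp add: cscale_minus_one)

lemma diff_commute: "m (x - y) = m (y - x)"
  using uminus[of "x - y"] by simp

lemma triangle_diff: "m (x - z) \<le> m (x - y) + m (y - z)"
  using triangle[of "x - y" "y - z"] by simp

lemma triangle_minus: "m (x - y) \<le> m x + m y"
  using triangle[of x "- y"] by (simp add: uminus)

lemma reverse_triangle: "\<bar>m x - m y\<bar> \<le> m (x - y)"
  using triangle[of "x - y" y] triangle[of "y - x" x] diff_commute[of x y] by simp

lemma sum_le: "m (sum f I) \<le> (\<Sum>i\<in>I. m (f i))"
  by (induction I rule: infinite_finite_induct) (auto intro: order_trans[OF triangle])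

lemma le_weighted_sum:
  "m x \<le> (\<Sum>i\<in>keys x. \<bar>lookup x i\<bar> * m (Poly_Mapping.single i 1))"
proof -
  have "Poly_Mapping.single i (lookup x i) = cscale (lookup x i) (Poly_Mapping.single i 1)" for i
    by (rule poly_mapping_eqI) (simp add: lookup_single when_def)
  then have "m (Poly_Mapping.single i (lookup x i)) = \<bar>lookup x i\<bar> * m (Poly_Mapping.single i 1)" for i
    by (simp add: scale)
  then show ?thesis
    using sum_le[of "\<lambda>i. Poly_Mapping.single i (lookup x i)" "keys x"]
    by (simp add: poly_mapping_sum_single)
qed

lemma tendsto_of_diff:
  assumes "(\<lambda>n. m (s n - t n)) \<longlonglongrightarrow> 0" "(\<lambda>n. m (s n)) \<longlonglongrightarrow> a"
  shows "(\<lambda>n. m (t n)) \<longlonglongrightarrow> a"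
proof -
  have "(\<lambda>n. m (t n) - m (s n)) \<longlonglongrightarrow> 0"
    by (rule Lim_null_comparison[OF _ assms(1)])
      (use reverse_triangle in \<open>auto simp: abs_minus_commute intro!: always_eventually\<close>)
  from tendsto_add[OF this assms(2)] show ?thesis by simp
qed

end

text \<open>Coordinates are rounded down to multiples of \<open>1 / Suc n\<close> and zeros stay
  zeros, so all approximants of \<open>x\<close> live on the finite support of
  \<open>x\<close>.\<close>

definition rapprox :: "c00 \<Rightarrow> nat \<Rightarrow> V" where
  "rapprox x n = Poly_Mapping.map (\<lambda>r. of_int \<lfloor>r * Suc n\<rfloor> / of_nat (Suc n)) x"

lemma lookup_rapprox: "lookup (rapprox x n) i = of_int \<lfloor>lookup x i * Suc n\<rfloor> / of_nat (Suc n)"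
  by (simp add: rapprox_def Poly_Mapping.map.rep_eq when_def)

lemma rapprox_error: "\<bar>lookup (x - embV (rapprox x n)) i\<bar> \<le> 1 / Suc n"
proof -
  define r where "r = lookup x i"
  have "r - of_int \<lfloor>r * Suc n\<rfloor> / real (Suc n) = (r * Suc n - of_int \<lfloor>r * Suc n\<rfloor>) / Suc n"
    by (simp add: field_simps)
  moreover have "\<bar>r * Suc n - of_int \<lfloor>r * Suc n\<rfloor>\<bar> \<le> 1" by linarith
  ultimately have "\<bar>r - of_int \<lfloor>r * Suc n\<rfloor> / real (Suc n)\<bar> \<le> 1 / Suc n"
    by (simp only: abs_divide) (simp add: divide_right_mono del: of_nat_Suc)
  then show ?thesis
    unfolding lookup_minus lookup_embV lookup_rapprox r_def
    by (simp add: of_rat_divide del: of_nat_Suc)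
qed

text \<open>On the fixed finite support of \<open>x\<close> the seminorm is bounded by a weighted
  sum of the coordinates, each of which has error at most \<open>1 / Suc n\<close>. Hence the same
  approximants work for every seminorm.\<close>

lemma (in c00_seminorm) rapprox_tendsto: "(\<lambda>n. m (x - embV (rapprox x n))) \<longlonglongrightarrow> 0"
proof -
  let ?S = "\<Sum>i\<in>keys x. m (Poly_Mapping.single i 1)"
  have "m (x - embV (rapprox x n)) \<le> ?S * (1 / Suc n)" for n
  proof -
    let ?d = "x - embV (rapprox x n)"
    have "keys ?d \<subseteq> keys x"
      by (auto simp: in_keys_iff lookup_minus lookup_rapprox)
    have "m ?d \<le> (\<Sum>i\<in>keys ?d. \<bar>lookup ?d i\<bar> * m (Poly_Mapping.single i 1))"
      by (rule le_weighted_sum)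
    also have "\<dots> \<le> (\<Sum>i\<in>keys x. \<bar>lookup ?d i\<bar> * m (Poly_Mapping.single i 1))"
      using \<open>keys ?d \<subseteq> keys x\<close> by (intro sum_mono2) auto
    also have "\<dots> \<le> (\<Sum>i\<in>keys x. 1 / Suc n * m (Poly_Mapping.single i 1))"
      by (intro sum_mono mult_right_mono rapprox_error) auto
    finally show ?thesis by (simp add: sum_distrib_right mult.commute flip: sum_divide_distrib)
  qed
  moreover have "(\<lambda>n. ?S * (1 / Suc n)) \<longlonglongrightarrow> ?S * 0"
    by (intro tendsto_mult tendsto_const LIMSEQ_Suc lim_1_over_n)
  ultimately show ?thesis
    by (intro Lim_null_comparison[of "\<lambda>n. m (x - embV (rapprox x n))" "\<lambda>n. ?S * (1 / Suc n)"])
      (auto intro!: always_eventually simp del: of_nat_Suc)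
qed

text \<open>Both seminorms are limits of their values along the same rational approximants. This
  gives the uniqueness behind the description operator in \<open>mubar\<close>.\<close>

lemma seminorm_c00_eqI:
  assumes "is_seminorm_c00 m" "is_seminorm_c00 m'" "\<And>v. m (embV v) = m' (embV v)"
  shows "m = m'"
proof
  fix x
  interpret c00_seminorm m by unfold_locales fact
  interpret m': c00_seminorm m' by unfold_locales fact
  have "(\<lambda>n. m (embV (rapprox x n))) \<longlonglongrightarrow> m x"
    by (rule tendsto_of_diff[OF rapprox_tendsto]) simp
  moreover have "(\<lambda>n. m (embV (rapprox x n))) \<longlonglongrightarrow> m' x"
    unfolding assms(3) by (rule m'.tendsto_of_diff[OF m'.rapprox_tendsto]) simp
  ultimately show "m x = m' x" by (rule LIMSEQ_unique)
qed

lemma mubar_eqI: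
  assumes "is_seminorm_c00 m" "\<And>v. m (embV v) = \<mu> v"
  shows "mubar \<mu> = m"
  unfolding mubar_def
  by (rule the_equality) (use assms seminorm_c00_eqI in auto)

lemma seminormsVD:
  assumes "\<mu> \<in> seminormsV"
  shows "0 \<le> \<mu> v" "\<mu> (vscale q v) = of_rat \<bar>q\<bar> * \<mu> v" "\<mu> (u + v) \<le> \<mu> u + \<mu> v"
  using assms by (auto simp: seminormsV_def)

text \<open>The extension of \<open>\<mu>\<close> is obtained as a limit along rational approximations that converge
  for a weighted \<open>\<ell>\<^sub>1\<close> seminorm dominating \<open>\<mu>\<close>.\<close>

definition l1_seminorm :: "(V \<Rightarrow> real) \<Rightarrow> c00 \<Rightarrow> real" where
  "l1_seminorm \<mu> x = (\<Sum>i\<in>keys x. \<bar>lookup x i\<bar> * \<mu> (Poly_Mapping.single i 1))"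

lemma l1_seminorm_superset:
  assumes "finite S" "keys x \<subseteq> S"
  shows "l1_seminorm \<mu> x = (\<Sum>i\<in>S. \<bar>lookup x i\<bar> * \<mu> (Poly_Mapping.single i 1))"
  unfolding l1_seminorm_def using assms by (intro sum.mono_neutral_left) (auto simp: in_keys_iff)

lemma is_seminorm_l1_seminorm:
  assumes "\<mu> \<in> seminormsV"
  shows "is_seminorm_c00 (l1_seminorm \<mu>)"
  unfolding is_seminorm_c00_def
proof (intro conjI allI)
  fix x y :: c00 and c :: real
  show "0 \<le> l1_seminorm \<mu> x"
    unfolding l1_seminorm_def by (intro sum_nonneg mult_nonneg_nonneg seminormsVD(1)[OF assms]) auto
  have "keys (cscale c x) \<subseteq> keys x" by (auto simp: in_keys_iff)
  from l1_seminorm_superset[OF _ this] show "l1_seminorm \<mu> (cscale c x) = \<bar>c\<bar> * l1_seminorm \<mu> x"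
    by (simp add: l1_seminorm_def sum_distrib_left abs_mult mult.assoc)
  let ?S = "keys x \<union> keys y"
  have "keys (x + y) \<subseteq> ?S" by (auto simp: in_keys_iff lookup_add)
  then have "l1_seminorm \<mu> (x + y) = (\<Sum>i\<in>?S. \<bar>lookup x i + lookup y i\<bar> * \<mu> (Poly_Mapping.single i 1))"
    by (simp add: l1_seminorm_superset[of ?S] lookup_add)
  also have "\<dots> \<le> (\<Sum>i\<in>?S. (\<bar>lookup x i\<bar> + \<bar>lookup y i\<bar>) * \<mu> (Poly_Mapping.single i 1))"
    by (intro sum_mono mult_right_mono seminormsVD(1)[OF assms]) auto
  also have "\<dots> = l1_seminorm \<mu> x + l1_seminorm \<mu> y"
    by (simp add: l1_seminorm_superset[of ?S] sum.distrib distrib_right)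
  finally show "l1_seminorm \<mu> (x + y) \<le> l1_seminorm \<mu> x + l1_seminorm \<mu> y" .
qed

lemma seminormsV_diff_commute:
  assumes "\<mu> \<in> seminormsV"
  shows "\<mu> (u - v) = \<mu> (v - u)"
proof -
  have "vscale (-1) (u - v) = v - u" by (rule poly_mapping_eqI) (simp add: lookup_minus)
  with seminormsVD(2)[OF assms, of "-1" "u - v"] show ?thesis by simp
qed

lemma seminormsV_le_l1:
  assumes "\<mu> \<in> seminormsV"
  shows "\<mu> v \<le> l1_seminorm \<mu> (embV v)"
proof -
  have z: "\<mu> 0 = 0" using seminormsVD(2)[OF assms, of 0 0] by (simp add: vscale_zero)
  have sum_le: "\<mu> (sum f I) \<le> (\<Sum>i\<in>I. \<mu> (f i))" for f and I :: "nat set"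
    by (induction I rule: infinite_finite_induct)
      (auto simp: z intro: order_trans[OF seminormsVD(3)[OF assms]])
  have "Poly_Mapping.single i (lookup v i) = vscale (lookup v i) (Poly_Mapping.single i 1)" for i
    by (rule poly_mapping_eqI) (simp add: lookup_single when_def)
  then have *: "\<mu> (Poly_Mapping.single i (lookup v i)) =
      \<bar>of_rat (lookup v i)\<bar> * \<mu> (Poly_Mapping.single i 1)" for i
    by (simp add: seminormsVD(2)[OF assms])
  have "keys (embV v) = keys v" by (auto simp: in_keys_iff)
  then show ?thesis
    using sum_le[of "\<lambda>i. Poly_Mapping.single i (lookup v i)" "keys v"]
    by (simp add: poly_mapping_sum_single l1_seminorm_def *)
qed

lemma mubar_ex:
  assumes \<mu>: "\<mu> \<in> seminormsV"
  obtains m where "is_seminorm_c00 m" "\<And>v. m (embV v) = \<mu> v"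
proof -
  let ?W = "l1_seminorm \<mu>"
  interpret W: c00_seminorm ?W by unfold_locales (rule is_seminorm_l1_seminorm[OF \<mu>])
  have lip: "\<bar>\<mu> u - \<mu> v\<bar> \<le> ?W (embV u - embV v)" for u v
    using seminormsVD(3)[OF \<mu>, of "u - v" v] seminormsVD(3)[OF \<mu>, of "v - u" u]
      seminormsV_le_l1[OF \<mu>, of "u - v"] seminormsV_diff_commute[OF \<mu>, of u v]
    by (simp add: embV_diff)
  define m where "m x = lim (\<lambda>n. \<mu> (rapprox x n))" for x
  have conv: "(\<lambda>n. \<mu> (rapprox x n)) \<longlonglongrightarrow> m x" for x
  proof -
    have "Cauchy (\<lambda>n. \<mu> (rapprox x n))"
    proof (rule metric_CauchyI)
      fix e :: real assume "0 < e"
      then obtain N where N: "\<And>n. n \<ge> N \<Longrightarrow> ?W (x - embV (rapprox x n)) < e / 2"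
        using order_tendstoD(2)[OF W.rapprox_tendsto, of "e / 2" x]
        by (auto simp: eventually_sequentially)
      have "dist (\<mu> (rapprox x i)) (\<mu> (rapprox x j)) < e" if "i \<ge> N" "j \<ge> N" for i j
        using lip[of "rapprox x i" "rapprox x j"] N[OF that(1)] N[OF that(2)]
          W.triangle_diff[of "embV (rapprox x i)" "embV (rapprox x j)" x]
          W.diff_commute[of x "embV (rapprox x i)"]
        by (simp add: dist_real_def)
      then show "\<exists>M. \<forall>i\<ge>M. \<forall>j\<ge>M. dist (\<mu> (rapprox x i)) (\<mu> (rapprox x j)) < e" by blast
    qed
    then show ?thesis
      unfolding m_def by (simp add: Cauchy_convergent convergent_LIMSEQ_iff[symmetric])
  qed
  \<comment> \<open>The value \<open>m x\<close> can be computed along any sequence that converges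
    to \<open>x\<close> for the dominating seminorm. The seminorm laws then follow by combining
    approximants of the arguments.\<close>
  have limit: "(\<lambda>n. \<mu> (v n)) \<longlonglongrightarrow> m x" if "(\<lambda>n. ?W (x - embV (v n))) \<longlonglongrightarrow> 0" for x v
  proof -
    have "(\<lambda>n. ?W (x - embV (v n)) + ?W (x - embV (rapprox x n))) \<longlonglongrightarrow> 0"
      using tendsto_add[OF that W.rapprox_tendsto[of x]] by simp
    then have "(\<lambda>n. \<mu> (v n) - \<mu> (rapprox x n)) \<longlonglongrightarrow> 0"
    proof (rule Lim_null_comparison[rotated], intro always_eventually allI)
      fix n
      show "norm (\<mu> (v n) - \<mu> (rapprox x n)) \<le> ?W (x - embV (v n)) + ?W (x - embV (rapprox x n))"
        using lip[of "v n" "rapprox x n"] W.diff_commute[of x "embV (v n)"]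
          W.triangle_diff[of "embV (v n)" "embV (rapprox x n)" x]
        by simp
    qed
    from tendsto_add[OF this conv[of x]] show ?thesis by simp
  qed
  have "m (embV v) = \<mu> v" for v
    using limit[of "embV v" "\<lambda>_. v"] by (simp add: LIMSEQ_const_iff)
  moreover have "is_seminorm_c00 m"
    unfolding is_seminorm_c00_def
  proof (intro conjI allI)
    fix x y c
    show "0 \<le> m x"
      by (rule LIMSEQ_le_const[OF conv]) (use seminormsVD(1)[OF \<mu>] in auto)
    have "(\<lambda>n. ?W ((x + y) - embV (rapprox x n + rapprox y n))) \<longlonglongrightarrow> 0"
    proof (rule Lim_null_comparison)
      show "(\<lambda>n. ?W (x - embV (rapprox x n)) + ?W (y - embV (rapprox y n))) \<longlonglongrightarrow> 0"
        using tendsto_add[OF W.rapprox_tendsto[of x] W.rapprox_tendsto[of y]] by simp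
      show "\<forall>\<^sub>F n in sequentially. norm (?W ((x + y) - embV (rapprox x n + rapprox y n)))
          \<le> ?W (x - embV (rapprox x n)) + ?W (y - embV (rapprox y n))"
        using W.triangle[of "x - embV (rapprox x n)" "y - embV (rapprox y n)" for n]
        by (intro always_eventually) (simp add: embV_add algebra_simps)
    qed
    from limit[OF this] show "m (x + y) \<le> m x + m y"
      by (rule LIMSEQ_le[OF _ tendsto_add[OF conv conv]]) (use seminormsVD(3)[OF \<mu>] in auto)
    obtain q where q: "(\<lambda>n. real_of_rat (q n)) \<longlonglongrightarrow> c"
      by (rule rat_sequence_tendsto)
    have "(\<lambda>n. ?W (cscale c x - embV (vscale (q n) (rapprox x n)))) \<longlonglongrightarrow> 0"
    proof (rule Lim_null_comparison)
      show "(\<lambda>n. \<bar>c - of_rat (q n)\<bar> * ?W x + \<bar>of_rat (q n)\<bar> * ?W (x - embV (rapprox x n))) \<longlonglongrightarrow> 0"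
        by (rule tendsto_eq_intros q W.rapprox_tendsto refl | simp)+
      have "norm (?W (cscale c x - embV (vscale (q n) (rapprox x n))))
          \<le> \<bar>c - of_rat (q n)\<bar> * ?W x + \<bar>of_rat (q n)\<bar> * ?W (x - embV (rapprox x n))" for n
      proof -
        have "cscale c x - embV (vscale (q n) (rapprox x n)) =
          cscale (c - of_rat (q n)) x + cscale (of_rat (q n)) (x - embV (rapprox x n))"
          by (rule poly_mapping_eqI) (simp add: lookup_add lookup_minus of_rat_mult algebra_simps)
        then show ?thesis
          using W.triangle[of "cscale (c - of_rat (q n)) x" "cscale (of_rat (q n)) (x - embV (rapprox x n))"]
          by (simp add: W.scale)
      qed
      then show "\<forall>\<^sub>F n in sequentially. norm (?W (cscale c x - embV (vscale (q n) (rapprox x n))))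
          \<le> \<bar>c - of_rat (q n)\<bar> * ?W x + \<bar>of_rat (q n)\<bar> * ?W (x - embV (rapprox x n))" by simp
    qed
    from limit[OF this] have "(\<lambda>n. \<bar>of_rat (q n)\<bar> * \<mu> (rapprox x n)) \<longlonglongrightarrow> m (cscale c x)"
      by (simp add: seminormsVD(2)[OF \<mu>])
    moreover have "(\<lambda>n. \<bar>of_rat (q n)\<bar> * \<mu> (rapprox x n)) \<longlonglongrightarrow> \<bar>c\<bar> * m x"
      by (intro tendsto_mult tendsto_rabs q conv)
    ultimately show "m (cscale c x) = \<bar>c\<bar> * m x" by (rule LIMSEQ_unique)
  qed
  ultimately show ?thesis using that by blast
qed

lemma mubar_seminorm:
  assumes "\<mu> \<in> seminormsV"
  shows "is_seminorm_c00 (mubar \<mu>)" and mubar_embV: "mubar \<mu> (embV v) = \<mu> v"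
proof -
  obtain m where m: "is_seminorm_c00 m" "\<And>v. m (embV v) = \<mu> v"
    using mubar_ex[OF assms] by blast
  moreover have "mubar \<mu> = m" by (rule mubar_eqI[OF m])
  ultimately show "is_seminorm_c00 (mubar \<mu>)" "mubar \<mu> (embV v) = \<mu> v" by simp_all
qed

subsection \<open>The completion\<close>

locale seminorm_code =
  fixes \<mu> :: "V \<Rightarrow> real"
  assumes code: "\<mu> \<in> seminormsV"
begin

sublocale c00_seminorm "mubar \<mu>"
  by unfold_locales (rule mubar_seminorm[OF code])

abbreviation "m \<equiv> mubar \<mu>"
abbreviation "X \<equiv> Xmu \<mu>"
abbreviation "\<nu> \<equiv> ns_norm X"
abbreviation "cls \<equiv> ccls \<mu>"

lemma const_csq: "(\<lambda>_. x) \<in> csq \<mu>"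
  by (simp add: csq_def)

lemma csqE:
  assumes "s \<in> csq \<mu>" "0 < e"
  obtains N where "\<And>i j. i \<ge> N \<Longrightarrow> j \<ge> N \<Longrightarrow> m (s i - s j) < e"
  using assms unfolding csq_def by blast

lemma csq_convergent:
  assumes "s \<in> csq \<mu>"
  shows "convergent (\<lambda>n. m (s n))"
proof (rule Cauchy_convergent, rule metric_CauchyI)
  fix e :: real assume "0 < e"
  then obtain N where "\<forall>i\<ge>N. \<forall>j\<ge>N. m (s i - s j) < e"
    using assms by (auto simp: csq_def)
  then show "\<exists>M. \<forall>i\<ge>M. \<forall>j\<ge>M. dist (m (s i)) (m (s j)) < e"
    unfolding dist_real_def using le_less_trans[OF reverse_triangle] by blast
qed

lemma csq_add:
  assumes "s \<in> csq \<mu>" "t \<in> csq \<mu>"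
  shows "(\<lambda>n. s n + t n) \<in> csq \<mu>"
  unfolding csq_def
proof (intro CollectI allI impI)
  fix e :: real assume "e > 0"
  then obtain N M where
    N: "\<And>i j. i \<ge> N \<Longrightarrow> j \<ge> N \<Longrightarrow> m (s i - s j) < e / 2" and
    M: "\<And>i j. i \<ge> M \<Longrightarrow> j \<ge> M \<Longrightarrow> m (t i - t j) < e / 2"
    using csqE[OF assms(1), of "e / 2"] csqE[OF assms(2), of "e / 2"] by (metis half_gt_zero)
  have "m (s i + t i - (s j + t j)) < e" if "i \<ge> max N M" "j \<ge> max N M" for i j
    using N[of i j] M[of i j] that triangle[of "s i - s j" "t i - t j"]
    by (simp add: algebra_simps)
  then show "\<exists>N. \<forall>i\<ge>N. \<forall>j\<ge>N. m (s i + t i - (s j + t j)) < e" by blast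
qed

lemma csq_cscale:
  assumes "s \<in> csq \<mu>"
  shows "(\<lambda>n. cscale c (s n)) \<in> csq \<mu>"
  unfolding csq_def
proof (intro CollectI allI impI)
  fix e :: real assume "e > 0"
  then have "e / (\<bar>c\<bar> + 1) > 0" by (simp add: add_nonneg_pos)
  then obtain N where N: "\<And>i j. i \<ge> N \<Longrightarrow> j \<ge> N \<Longrightarrow> m (s i - s j) < e / (\<bar>c\<bar> + 1)"
    using csqE[OF assms] by metis
  have "m (cscale c (s i) - cscale c (s j)) < e" if "i \<ge> N" "j \<ge> N" for i j
  proof -
    have "m (cscale c (s i) - cscale c (s j)) = \<bar>c\<bar> * m (s i - s j)"
      by (simp add: scale flip: cscale_diff)
    also have "\<dots> \<le> (\<bar>c\<bar> + 1) * m (s i - s j)" by (intro mult_right_mono) auto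
    also have "\<dots> < e" using N[OF that] by (simp add: field_simps add_nonneg_pos pos_less_divide_eq)
    finally show ?thesis .
  qed
  then show "\<exists>N. \<forall>i\<ge>N. \<forall>j\<ge>N. m (cscale c (s i) - cscale c (s j)) < e" by blast
qed

text \<open>By the triangle inequality, being at distance tending to zero is transitive. The
  operations of \<open>Xmu\<close> go through the chosen representative \<open>crep\<close>; this
  lemma lets them be computed termwise on any representative.\<close>

lemma cls_eqI:
  assumes "(\<lambda>n. m (s n - t n)) \<longlonglongrightarrow> 0"
  shows "cls s = cls t"
proof -
  have *: "(\<lambda>n. m (b n - u n)) \<longlonglongrightarrow> 0"
    if "(\<lambda>n. m (a n - b n)) \<longlonglongrightarrow> 0" "(\<lambda>n. m (a n - u n)) \<longlonglongrightarrow> 0" for a b u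
  proof (rule Lim_null_comparison)
    show "(\<lambda>n. m (a n - b n) + m (a n - u n)) \<longlonglongrightarrow> 0" using tendsto_add[OF that] by simp
    show "\<forall>\<^sub>F n in sequentially. norm (m (b n - u n)) \<le> m (a n - b n) + m (a n - u n)"
      using triangle_diff[of "b n" "u n" "a n" for n]
      by (intro always_eventually allI) (simp add: diff_commute[of "b _" "a _"])
  qed
  have "(\<lambda>n. m (t n - s n)) \<longlonglongrightarrow> 0" using assms by (simp add: diff_commute)
  with *[of s t] *[of t s] assms show ?thesis unfolding ccls_def by blast
qed

lemma crep_cls:
  assumes "s \<in> csq \<mu>"
  shows "crep (cls s) \<in> csq \<mu>" "(\<lambda>n. m (s n - crep (cls s) n)) \<longlonglongrightarrow> 0"
proof -
  have "s \<in> cls s" using assms by (simp add: ccls_def)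
  then have "crep (cls s) \<in> cls s" unfolding crep_def by (rule someI[where P = "\<lambda>t. t \<in> cls s"])
  then show "crep (cls s) \<in> csq \<mu>" "(\<lambda>n. m (s n - crep (cls s) n)) \<longlonglongrightarrow> 0"
    by (auto simp: ccls_def)
qed

lemma carrier_eq: "ns_carrier X = cls ` csq \<mu>"
  by (auto simp: Xmu_def)

lemma norm_cls:
  assumes "s \<in> csq \<mu>"
  shows "(\<lambda>n. m (s n)) \<longlonglongrightarrow> \<nu> (cls s)"
proof -
  have 1: "(\<lambda>n. m (s n)) \<longlonglongrightarrow> lim (\<lambda>n. m (s n))"
    using csq_convergent[OF assms] by (simp add: convergent_LIMSEQ_iff)
  from tendsto_of_diff[OF crep_cls(2)[OF assms] this]
  have "lim (\<lambda>n. m (crep (cls s) n)) = lim (\<lambda>n. m (s n))" by (rule limI)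
  with 1 show ?thesis by (simp add: Xmu_def)
qed

lemma add_cls:
  assumes "s \<in> csq \<mu>" "t \<in> csq \<mu>"
  shows "ns_add X (cls s) (cls t) = cls (\<lambda>n. s n + t n)"
proof -
  have "(\<lambda>n. m ((s n + t n) - (crep (cls s) n + crep (cls t) n))) \<longlonglongrightarrow> 0"
  proof (rule Lim_null_comparison)
    show "(\<lambda>n. m (s n - crep (cls s) n) + m (t n - crep (cls t) n)) \<longlonglongrightarrow> 0"
      using tendsto_add[OF crep_cls(2)[OF assms(1)] crep_cls(2)[OF assms(2)]] by simp
    show "\<forall>\<^sub>F n in sequentially. norm (m ((s n + t n) - (crep (cls s) n + crep (cls t) n)))
        \<le> m (s n - crep (cls s) n) + m (t n - crep (cls t) n)"
      using triangle[of "s n - crep (cls s) n" "t n - crep (cls t) n" for n]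
      by (intro always_eventually) (simp add: algebra_simps)
  qed
  then show ?thesis by (simp add: Xmu_def cls_eqI)
qed

lemma scale_cls:
  assumes "s \<in> csq \<mu>"
  shows "ns_scale X c (cls s) = cls (\<lambda>n. cscale c (s n))"
proof -
  have "(\<lambda>n. m (cscale c (s n) - cscale c (crep (cls s) n))) \<longlonglongrightarrow> 0"
    unfolding cscale_diff[symmetric] scale
    using tendsto_mult[OF tendsto_const crep_cls(2)[OF assms]] by simp
  then show ?thesis by (simp add: Xmu_def cls_eqI)
qed

lemma csq_diff:
  assumes "s \<in> csq \<mu>" "t \<in> csq \<mu>"
  shows "(\<lambda>n. s n - t n) \<in> csq \<mu>"
  using csq_add[OF assms(1) csq_cscale[OF assms(2), of "-1"]] by (simp add: cscale_minus_one)

lemma diff_cls: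
  assumes "s \<in> csq \<mu>" "t \<in> csq \<mu>"
  shows "ns_diff X (cls s) (cls t) = cls (\<lambda>n. s n - t n)"
  unfolding ns_diff_def scale_cls[OF assms(2)] add_cls[OF assms(1) csq_cscale[OF assms(2)]]
  by (simp add: cscale_minus_one)

lemma carrier_closed:
  assumes "A \<in> ns_carrier X" "B \<in> ns_carrier X"
  shows "ns_add X A B \<in> ns_carrier X" "ns_scale X c A \<in> ns_carrier X" "ns_diff X A B \<in> ns_carrier X"
  using assms by (auto simp: carrier_eq add_cls scale_cls diff_cls csq_add csq_cscale csq_diff)

lemma norm_nonneg:
  assumes "A \<in> ns_carrier X"
  shows "0 \<le> \<nu> A"
  using assms by (auto simp: carrier_eq intro!: LIMSEQ_le_const[OF norm_cls])

lemma norm_diff_triangle: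
  assumes "A \<in> ns_carrier X" "B \<in> ns_carrier X" "C \<in> ns_carrier X"
  shows "\<nu> (ns_diff X A C) \<le> \<nu> (ns_diff X A B) + \<nu> (ns_diff X B C)"
proof -
  obtain s t u where *: "A = cls s" "B = cls t" "C = cls u" "s \<in> csq \<mu>" "t \<in> csq \<mu>" "u \<in> csq \<mu>"
    using assms by (auto simp: carrier_eq)
  have "\<nu> (cls (\<lambda>n. s n - u n)) \<le> \<nu> (cls (\<lambda>n. s n - t n)) + \<nu> (cls (\<lambda>n. t n - u n))"
    by (rule LIMSEQ_le[OF norm_cls tendsto_add[OF norm_cls norm_cls]])
      (use * csq_diff triangle_diff in auto)
  with * show ?thesis by (simp add: diff_cls)
qed

lemma norm_diff_commute:
  assumes "A \<in> ns_carrier X" "B \<in> ns_carrier X"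
  shows "\<nu> (ns_diff X A B) = \<nu> (ns_diff X B A)"
proof -
  obtain s t where *: "A = cls s" "B = cls t" "s \<in> csq \<mu>" "t \<in> csq \<mu>"
    using assms by (auto simp: carrier_eq)
  show ?thesis
    using LIMSEQ_unique[OF norm_cls[OF csq_diff, of s t], unfolded diff_commute[of "s _"],
        OF _ _ norm_cls[OF csq_diff, of t s]] *
    by (simp add: diff_cls)
qed

lemma norm_diff_le:
  assumes "A \<in> ns_carrier X" "B \<in> ns_carrier X"
  shows "\<nu> (ns_diff X A B) \<le> \<nu> A + \<nu> B" "\<nu> A \<le> \<nu> B + \<nu> (ns_diff X A B)"
proof -
  obtain s t where *: "A = cls s" "B = cls t" "s \<in> csq \<mu>" "t \<in> csq \<mu>"
    using assms by (auto simp: carrier_eq)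
  have "\<nu> (cls (\<lambda>n. s n - t n)) \<le> \<nu> (cls s) + \<nu> (cls t)"
    by (rule LIMSEQ_le[OF norm_cls tendsto_add[OF norm_cls norm_cls]])
      (use * csq_diff triangle_minus in auto)
  moreover have "\<nu> (cls s) \<le> \<nu> (cls t) + \<nu> (cls (\<lambda>n. s n - t n))"
    by (rule LIMSEQ_le[OF norm_cls tendsto_add[OF norm_cls norm_cls]])
      (use * csq_diff triangle[of "t n" "s n - t n" for n] in auto)
  ultimately show "\<nu> (ns_diff X A B) \<le> \<nu> A + \<nu> B" "\<nu> A \<le> \<nu> B + \<nu> (ns_diff X A B)"
    using * by (simp_all add: diff_cls)
qed

text \<open>The canonical map of \<open>V\<close> into the completion; it carries \<mu> to the norm
  and has dense image.\<close>

definition J :: "V \<Rightarrow> (nat \<Rightarrow> c00) set" where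
  "J v = cls (\<lambda>_. embV v)"

lemma J_carrier: "J v \<in> ns_carrier X"
  by (simp add: J_def carrier_eq const_csq)

lemma J_add: "ns_add X (J u) (J v) = J (u + v)"
  by (simp add: J_def add_cls const_csq embV_add)

lemma J_scale: "ns_scale X (of_rat q) (J v) = J (vscale q v)"
  by (simp add: J_def scale_cls const_csq embV_vscale)

lemma J_diff: "ns_diff X (J u) (J v) = J (u - v)"
  by (simp add: J_def diff_cls const_csq embV_diff)

lemma norm_J: "\<nu> (J v) = \<mu> v"
  using norm_cls[OF const_csq, of "embV v"] mubar_embV[OF code, of v]
  by (simp add: J_def LIMSEQ_const_iff)

text \<open>A late term of a representing Cauchy sequence is close to the class, and that term is
  close to a rational vector.\<close>

lemma J_dense:
  assumes "A \<in> ns_carrier X" "0 < e"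
  obtains v where "\<nu> (ns_diff X A (J v)) < e"
proof -
  obtain s where s: "A = cls s" "s \<in> csq \<mu>"
    using assms by (auto simp: carrier_eq)
  obtain N where N: "\<And>i j. i \<ge> N \<Longrightarrow> j \<ge> N \<Longrightarrow> m (s i - s j) < e / 3"
    using csqE[OF s(2), of "e / 3"] assms(2) by auto
  have "eventually (\<lambda>n. m (s N - embV (rapprox (s N) n)) < e / 3) sequentially"
    using order_tendstoD(2)[OF rapprox_tendsto[of "s N"], of "e / 3"] assms(2) by simp
  then obtain v where v: "m (s N - embV v) < e / 3"
    by (auto simp: eventually_sequentially)
  have "\<nu> (cls (\<lambda>n. s n - embV v)) \<le> 2 * e / 3"
  proof (rule LIMSEQ_le_const2[OF norm_cls])
    have "m (s n - embV v) \<le> 2 * e / 3" if "n \<ge> N" for n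
      using N[OF that order_refl] v triangle_diff[of "s n" "embV v" "s N"] by linarith
    then show "\<exists>N. \<forall>n\<ge>N. m (s n - embV v) \<le> 2 * e / 3" by blast
  qed (rule csq_diff[OF s(2) const_csq])
  with s assms(2) that[of v] show thesis by (simp add: J_def diff_cls const_csq)
qed

end

subsection \<open>The diameter two property tested on rational vectors\<close>

context seminorm_code
begin

definition Jc :: "c00 \<Rightarrow> (nat \<Rightarrow> c00) set" where
  "Jc x = cls (\<lambda>_. x)"

lemma norm_Jc: "\<nu> (Jc x) = m x"
  using norm_cls[OF const_csq, of x] by (simp add: Jc_def LIMSEQ_const_iff)

lemma Jc_eqD:
  assumes "Jc x = Jc y"
  shows "m (x - y) = 0"
proof -
  have "ns_diff X (Jc x) (Jc y) = ns_diff X (Jc y) (Jc y)" using assms by simp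
  then have "Jc (x - y) = Jc 0" by (simp add: Jc_def diff_cls const_csq)
  then show ?thesis using norm_Jc[of "x - y"] norm_Jc[of 0] by simp
qed

lemma lincomb_Jc:
  "ns_lincomb X cs (map Jc ys) = Jc (foldr (\<lambda>(c, y) z. cscale c y + z) (zip cs ys) 0)"
proof (induction cs ys rule: list_induct2')
  case (4 c cs y ys)
  then show ?case
    by (simp add: ns_lincomb_def Jc_def scale_cls add_cls const_csq)
qed (simp_all add: ns_lincomb_def Jc_def Xmu_def)

text \<open>The canonical map of \<open>c00\<close> into the completion is then injective, so the
  images of the first \<open>n\<close> unit vectors remain linearly independent.\<close>

lemma infdim_if_norm:
  assumes norm: "\<And>x. m x = 0 \<Longrightarrow> x = 0"
  shows "ns_infdim X"
  unfolding ns_infdim_def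
proof
  fix n
  define ys :: "c00 list" where "ys = map (\<lambda>i. Poly_Mapping.single i 1) [0..<n]"
  define xs where "xs = map Jc ys"
  have len: "length xs = n" by (simp add: xs_def ys_def)
  have "inj Jc" using Jc_eqD norm by (metis eq_iff_diff_eq_0 injI)
  moreover have "inj (\<lambda>i::nat. Poly_Mapping.single i (1::real))"
    by (rule injI) (metis lookup_single_eq lookup_single_not_eq zero_neq_one)
  ultimately have "distinct xs"
    unfolding xs_def ys_def map_map distinct_map
    by (meson distinct_upt inj_compose inj_on_subset subset_UNIV)
  moreover have "set xs \<subseteq> ns_carrier X"
    by (auto simp: xs_def Jc_def carrier_eq const_csq)
  moreover have "\<forall>c\<in>set cs. c = 0" if "length cs = n" "ns_lincomb X cs xs = ns_zero X" for cs
  proof -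
    let ?z = "foldr (\<lambda>(c, y) z. cscale c y + z) (zip cs ys) 0"
    have "Jc ?z = Jc 0"
      using that(2) lincomb_Jc[of cs ys] by (simp add: xs_def Jc_def Xmu_def)
    then have z: "?z = 0" using \<open>inj Jc\<close> by (simp add: inj_eq)
    have look: "lookup (foldr (\<lambda>(c, y) z. cscale c y + z) l 0) i =
        (\<Sum>(c, y)\<leftarrow>l. c * lookup y i)" for l i
      by (induction l) (auto simp: lookup_add)
    have "cs ! i = 0" if "i < n" for i
    proof -
      have "(\<Sum>(c, y)\<leftarrow>zip cs ys. c * lookup y i) = (\<Sum>j<n. cs ! j * lookup (ys ! j) i)"
        using \<open>length cs = n\<close>
        by (simp add: sum_list_sum_nth ys_def atLeast0LessThan)
      also have "\<dots> = (\<Sum>j<n. if i = j then cs ! j else 0)"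
        by (intro sum.cong) (auto simp: ys_def lookup_single when_def)
      also have "\<dots> = cs ! i" using that by simp
      finally show ?thesis using look[of "zip cs ys" i] z by simp
    qed
    then show ?thesis using that(1) by (metis in_set_conv_nth)
  qed
  ultimately show "\<exists>xs. length xs = n \<and> distinct xs \<and> set xs \<subseteq> ns_carrier X \<and>
      (\<forall>cs. length cs = n \<and> ns_lincomb X cs xs = ns_zero X \<longrightarrow> (\<forall>c\<in>set cs. c = 0))"
    using len by blast
qed

end

text \<open>The dual unit ball of the completion, seen through restriction to \<open>V\<close>:
  rational linearity and domination by \<mu> already determine a bounded real functional
  there.\<close>

definition dual_ballV :: "(V \<Rightarrow> real) \<Rightarrow> (V \<Rightarrow> real) set" where
  "dual_ballV \<mu> = {f. (\<forall>u v. f (u + v) = f u + f v) \<and> (\<forall>q v. f (vscale q v) = of_rat q * f v) \<and>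
     (\<forall>v. \<bar>f v\<bar> \<le> \<mu> v)}"

lemma dual_ballV_D:
  assumes "f \<in> dual_ballV \<mu>"
  shows "f (u + v) = f u + f v" "f (vscale q v) = of_rat q * f v" "\<bar>f v\<bar> \<le> \<mu> v" "f (u - v) = f u - f v"
proof -
  show *: "f (u + v) = f u + f v" "f (vscale q v) = of_rat q * f v" "\<bar>f v\<bar> \<le> \<mu> v" for u
    using assms by (auto simp: dual_ballV_def)
  show "f (u - v) = f u - f v" using *(1)[of "u - v"] by simp
qed

section \<open>Extension of functionals from rational vectors to the completion\<close>

context seminorm_code
begin

lemma norm_add_approx:
  assumes "A \<in> ns_carrier X" "B \<in> ns_carrier X"
  shows "\<nu> (ns_diff X (ns_add X A B) (J (u + v))) \<le> \<nu> (ns_diff X A (J u)) + \<nu> (ns_diff X B (J v))"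
proof -
  obtain s t where *: "A = cls s" "B = cls t" "s \<in> csq \<mu>" "t \<in> csq \<mu>"
    using assms by (auto simp: carrier_eq)
  have "\<nu> (cls (\<lambda>n. s n + t n - embV (u + v))) \<le> \<nu> (cls (\<lambda>n. s n - embV u)) + \<nu> (cls (\<lambda>n. t n - embV v))"
  proof (rule LIMSEQ_le[OF norm_cls tendsto_add[OF norm_cls norm_cls]])
    show "\<exists>N. \<forall>n\<ge>N. m (s n + t n - embV (u + v)) \<le> m (s n - embV u) + m (t n - embV v)"
      using triangle[of "s n - embV u" "t n - embV v" for n] by (simp add: embV_add algebra_simps)
  qed (use * csq_diff csq_add const_csq in auto)
  with * show ?thesis by (simp add: J_def add_cls diff_cls csq_add const_csq)
qed

lemma norm_scale_approx:
  assumes "A \<in> ns_carrier X"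
  shows "\<nu> (ns_diff X (ns_scale X c A) (J (vscale q v)))
    \<le> \<bar>c - of_rat q\<bar> * \<nu> A + \<bar>of_rat q\<bar> * \<nu> (ns_diff X A (J v))"
proof -
  obtain s where *: "A = cls s" "s \<in> csq \<mu>"
    using assms by (auto simp: carrier_eq)
  have "\<nu> (cls (\<lambda>n. cscale c (s n) - embV (vscale q v)))
    \<le> \<bar>c - of_rat q\<bar> * \<nu> (cls s) + \<bar>of_rat q\<bar> * \<nu> (cls (\<lambda>n. s n - embV v))"
  proof (rule LIMSEQ_le[OF norm_cls tendsto_add[OF tendsto_mult[OF tendsto_const norm_cls]
          tendsto_mult[OF tendsto_const norm_cls]]])
    have "m (cscale c (s n) - embV (vscale q v)) \<le> \<bar>c - of_rat q\<bar> * m (s n) + \<bar>of_rat q\<bar> * m (s n - embV v)" for n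
    proof -
      have "cscale c (s n) - embV (vscale q v) = cscale (c - of_rat q) (s n) + cscale (of_rat q) (s n - embV v)"
        by (rule poly_mapping_eqI) (simp add: lookup_add lookup_minus of_rat_mult algebra_simps)
      then show ?thesis
        using triangle[of "cscale (c - of_rat q) (s n)" "cscale (of_rat q) (s n - embV v)"]
        by (simp add: scale)
    qed
    then show "\<exists>N. \<forall>n\<ge>N. m (cscale c (s n) - embV (vscale q v))
        \<le> \<bar>c - of_rat q\<bar> * m (s n) + \<bar>of_rat q\<bar> * m (s n - embV v)" by blast
  qed (use * csq_diff csq_cscale const_csq in auto)
  with * show ?thesis by (simp add: J_def scale_cls diff_cls csq_cscale const_csq)
qed

text \<open>Domination by \<mu> makes \<open>f\<close> Lipschitz on the dense image of
  \<open>V\<close>, so it extends by continuity with the same bound.\<close>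

lemma dual_extension:
  assumes f: "f \<in> dual_ballV \<mu>"
  obtains \<phi> where "\<phi> \<in> ns_dual X" "\<And>v. \<phi> (J v) = f v" "\<And>A. A \<in> ns_carrier X \<Longrightarrow> \<bar>\<phi> A\<bar> \<le> \<nu> A"
proof -
  have lip: "\<bar>f u - f v\<bar> \<le> \<nu> (ns_diff X A (J u)) + \<nu> (ns_diff X A (J v))"
    if "A \<in> ns_carrier X" for u v A
    using dual_ballV_D(3)[OF f, of "u - v"] norm_diff_triangle[OF J_carrier that J_carrier, of u v]
      norm_diff_commute[OF J_carrier that, of u]
    by (simp add: dual_ballV_D(4)[OF f] J_diff norm_J)
  define a where "a A n = (SOME v. \<nu> (ns_diff X A (J v)) < 1 / Suc n)" for A n
  have a: "\<nu> (ns_diff X A (J (a A n))) < 1 / Suc n" if "A \<in> ns_carrier X" for A n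
    unfolding a_def by (rule someI_ex) (use J_dense[OF that, of "1 / Suc n"] in auto)
  have a0: "(\<lambda>n. \<nu> (ns_diff X A (J (a A n)))) \<longlonglongrightarrow> 0" if "A \<in> ns_carrier X" for A
  proof (rule Lim_null_comparison)
    show "(\<lambda>n. 1 / real (Suc n)) \<longlonglongrightarrow> 0" by (rule LIMSEQ_Suc[OF lim_1_over_n])
    show "\<forall>\<^sub>F n in sequentially. norm (\<nu> (ns_diff X A (J (a A n)))) \<le> 1 / real (Suc n)"
      using a[OF that] norm_nonneg[OF carrier_closed(3)[OF that J_carrier]]
      by (intro always_eventually) (simp add: less_imp_le)
  qed
  define \<phi> where "\<phi> A = lim (\<lambda>n. f (a A n))" for A
  have conv: "(\<lambda>n. f (a A n)) \<longlonglongrightarrow> \<phi> A" if A: "A \<in> ns_carrier X" for A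
  proof -
    have "Cauchy (\<lambda>n. f (a A n))"
    proof (rule metric_CauchyI)
      fix e :: real assume "0 < e"
      then obtain N where N: "\<And>n. n \<ge> N \<Longrightarrow> \<nu> (ns_diff X A (J (a A n))) < e / 2"
        using order_tendstoD(2)[OF a0[OF A], of "e / 2"]
        by (auto simp: eventually_sequentially)
      have "dist (f (a A i)) (f (a A j)) < e" if "i \<ge> N" "j \<ge> N" for i j
        using lip[OF A, of "a A i" "a A j"] N[OF that(1)] N[OF that(2)]
        by (simp add: dist_real_def)
      then show "\<exists>M. \<forall>i\<ge>M. \<forall>j\<ge>M. dist (f (a A i)) (f (a A j)) < e" by blast
    qed
    then show ?thesis
      unfolding \<phi>_def by (simp add: Cauchy_convergent convergent_LIMSEQ_iff[symmetric])
  qed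
  \<comment> \<open>Independence of the approximating sequence: sums and multiples of approximants
    may be used to check additivity and homogeneity.\<close>
  have limit: "(\<lambda>n. f (v n)) \<longlonglongrightarrow> \<phi> A"
    if A: "A \<in> ns_carrier X" and v: "(\<lambda>n. \<nu> (ns_diff X A (J (v n)))) \<longlonglongrightarrow> 0" for A v
  proof -
    have "(\<lambda>n. \<nu> (ns_diff X A (J (v n))) + \<nu> (ns_diff X A (J (a A n)))) \<longlonglongrightarrow> 0"
      using tendsto_add[OF v a0[OF A]] by simp
    then have "(\<lambda>n. f (v n) - f (a A n)) \<longlonglongrightarrow> 0"
      by (rule Lim_null_comparison[rotated]) (use lip[OF A] in \<open>simp add: always_eventually\<close>)
    from tendsto_add[OF this conv[OF A]] show ?thesis by simp
  qed
  have \<phi>J: "\<phi> (J v) = f v" for v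
    using limit[OF J_carrier, of v "\<lambda>_. v"] seminormsVD(2)[OF code, of 0 0]
    by (simp add: LIMSEQ_const_iff J_diff norm_J vscale_zero)
  have bound: "\<bar>\<phi> A\<bar> \<le> \<nu> A" if A: "A \<in> ns_carrier X" for A
  proof (rule LIMSEQ_le[OF tendsto_rabs[OF conv[OF A]]])
    show "(\<lambda>n. \<nu> A + \<nu> (ns_diff X A (J (a A n)))) \<longlonglongrightarrow> \<nu> A"
      using tendsto_add[OF tendsto_const a0[OF A]] by simp
    have "\<bar>f v\<bar> \<le> \<nu> A + \<nu> (ns_diff X A (J v))" for v
      using dual_ballV_D(3)[OF f, of v] norm_diff_le(2)[OF J_carrier A, of v]
        norm_diff_commute[OF A J_carrier, of v] by (simp add: norm_J)
    then show "\<exists>N. \<forall>n\<ge>N. \<bar>f (a A n)\<bar> \<le> \<nu> A + \<nu> (ns_diff X A (J (a A n)))" by blast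
  qed
  have add: "\<phi> (ns_add X A B) = \<phi> A + \<phi> B" if A: "A \<in> ns_carrier X" and B: "B \<in> ns_carrier X" for A B
  proof -
    have "(\<lambda>n. \<nu> (ns_diff X (ns_add X A B) (J (a A n + a B n)))) \<longlonglongrightarrow> 0"
    proof (rule Lim_null_comparison)
      show "(\<lambda>n. \<nu> (ns_diff X A (J (a A n))) + \<nu> (ns_diff X B (J (a B n)))) \<longlonglongrightarrow> 0"
        using tendsto_add[OF a0[OF A] a0[OF B]] by simp
      show "\<forall>\<^sub>F n in sequentially. norm (\<nu> (ns_diff X (ns_add X A B) (J (a A n + a B n))))
          \<le> \<nu> (ns_diff X A (J (a A n))) + \<nu> (ns_diff X B (J (a B n)))"
        using norm_add_approx[OF A B] norm_nonneg[OF carrier_closed(3)[OF carrier_closed(1)[OF A B] J_carrier]]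
        by (intro always_eventually) simp
    qed
    from limit[OF carrier_closed(1)[OF A B] this]
    have "(\<lambda>n. f (a A n) + f (a B n)) \<longlonglongrightarrow> \<phi> (ns_add X A B)"
      by (simp add: dual_ballV_D(1)[OF f])
    with tendsto_add[OF conv[OF A] conv[OF B]] show ?thesis by (rule LIMSEQ_unique[rotated])
  qed
  have scal: "\<phi> (ns_scale X c A) = c * \<phi> A" if A: "A \<in> ns_carrier X" for A c
  proof -
    note cA = carrier_closed(2)[OF A A, of c]
    obtain q where q: "(\<lambda>n. real_of_rat (q n)) \<longlonglongrightarrow> c"
      by (rule rat_sequence_tendsto)
    have "(\<lambda>n. \<nu> (ns_diff X (ns_scale X c A) (J (vscale (q n) (a A n))))) \<longlonglongrightarrow> 0"
    proof (rule Lim_null_comparison)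
      show "(\<lambda>n. \<bar>c - of_rat (q n)\<bar> * \<nu> A + \<bar>of_rat (q n)\<bar> * \<nu> (ns_diff X A (J (a A n)))) \<longlonglongrightarrow> 0"
        by (rule tendsto_eq_intros q a0[OF A] refl | simp)+
      show "\<forall>\<^sub>F n in sequentially. norm (\<nu> (ns_diff X (ns_scale X c A) (J (vscale (q n) (a A n)))))
          \<le> \<bar>c - of_rat (q n)\<bar> * \<nu> A + \<bar>of_rat (q n)\<bar> * \<nu> (ns_diff X A (J (a A n)))"
        using norm_scale_approx[OF A] norm_nonneg[OF carrier_closed(3)[OF cA J_carrier]]
        by (intro always_eventually) simp
    qed
    from limit[OF cA this]
    have "(\<lambda>n. of_rat (q n) * f (a A n)) \<longlonglongrightarrow> \<phi> (ns_scale X c A)"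
      by (simp add: dual_ballV_D(2)[OF f])
    with tendsto_mult[OF q conv[OF A]] show ?thesis by (rule LIMSEQ_unique[rotated])
  qed
  have "\<phi> \<in> ns_dual X"
    unfolding ns_dual_def using add scal bound by (auto intro!: exI[of _ 1])
  then show thesis using that \<phi>J bound by blast
qed

text \<open>A rational vector near a point of the closed ball may have norm slightly above 1.
  Shrinking it by the factor \<open>1 - q\<close> brings it into the open ball, since (1 - q)(1 + q)
  < 1.\<close>

lemma ball_approx:
  assumes "A \<in> ns_ball X" "0 < e"
  obtains v where "\<mu> v < 1" "\<nu> (ns_diff X A (J v)) < e"
proof -
  have A: "A \<in> ns_carrier X" "\<nu> A \<le> 1" using assms(1) by (auto simp: ns_ball_def)
  \<comment> \<open>The approximation costs less than \<open>q\<close> and the shrinking at most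
    \<open>2 * q\<close>, which explains the third of \<open>e\<close>.\<close>
  obtain q where q: "0 < real_of_rat q" "real_of_rat q < min 1 (e / 3)"
    using of_rat_dense[of 0 "min 1 (e / 3)"] assms(2) by auto
  let ?q = "real_of_rat q"
  obtain v where v: "\<nu> (ns_diff X A (J v)) < ?q" using J_dense[OF A(1) q(1)] .
  have \<mu>v: "\<mu> v < 1 + ?q" "0 \<le> \<mu> v"
    using norm_diff_le(2)[OF J_carrier A(1), of v] norm_diff_commute[OF J_carrier A(1), of v] v A(2)
      seminormsVD(1)[OF code]
    by (simp_all add: norm_J)
  let ?x = "vscale (1 - q) v"
  have "\<mu> ?x = (1 - ?q) * \<mu> v"
    using q(2) by (subst seminormsVD(2)[OF code]) (simp add: of_rat_diff flip: of_rat_less)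
  also have "\<dots> \<le> (1 - ?q) * (1 + ?q)" using q \<mu>v by (intro mult_left_mono) auto
  also have "\<dots> < 1" using q by (simp add: algebra_simps)
  finally have "\<mu> ?x < 1" .
  moreover have "v - ?x = vscale q v"
    by (rule poly_mapping_eqI) (simp add: lookup_minus algebra_simps)
  then have "\<nu> (ns_diff X (J v) (J ?x)) = ?q * \<mu> v"
    using q(1) by (simp add: J_diff norm_J seminormsVD(2)[OF code])
  moreover have "?q * \<mu> v \<le> ?q * 2"
    using q \<mu>v by (intro mult_left_mono) (auto simp del: of_rat_less_1_iff)
  moreover have "\<nu> (ns_diff X A (J ?x)) \<le> \<nu> (ns_diff X A (J v)) + \<nu> (ns_diff X (J v) (J ?x))"
    by (rule norm_diff_triangle[OF A(1) J_carrier J_carrier])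
  ultimately have "\<nu> (ns_diff X A (J ?x)) < e" using v q(2) by linarith
  with \<open>\<mu> ?x < 1\<close> show thesis by (rule that)
qed

end

section \<open>Basic weak neighbourhoods\<close>

lemma ns_weak_openE:
  assumes "openin (ns_weak X) W" "a \<in> W"
  obtains F e where "finite F" "F \<subseteq> ns_dual X" "0 < e"
    "\<forall>x\<in>ns_carrier X. (\<forall>\<phi>\<in>F. \<bar>\<phi> x - \<phi> a\<bar> < e) \<longrightarrow> x \<in> W"
proof -
  let ?S = "{{x \<in> ns_carrier X. \<phi> x \<in> U} | \<phi> U. \<phi> \<in> ns_dual X \<and> open U}"
  let ?N = "\<lambda>T a. \<exists>F e. finite F \<and> F \<subseteq> ns_dual X \<and> 0 < e \<and>
    (\<forall>x\<in>ns_carrier X. (\<forall>\<phi>\<in>F. \<bar>\<phi> x - \<phi> a\<bar> < e) \<longrightarrow> x \<in> T)"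
  obtain T where T: "generate_topology_on ?S T" "W = T \<inter> ns_carrier X"
    using assms(1)[unfolded ns_weak_def openin_subtopology openin_topology_generated_by_iff]
    by (elim exE conjE) (rule that)
  \<comment> \<open>Induction on how the open set is generated: an intersection takes the union of
    the two finite sets of functionals and the smaller tolerance, a union keeps the data of one
    member containing \<open>a\<close>.\<close>
  from T(1) have "a \<in> T \<Longrightarrow> ?N T a"
  proof (induction rule: generate_topology_on.induct)
    case (Int S T)
    then obtain F e G d where *: "finite F" "F \<subseteq> ns_dual X" "0 < e"
      "\<forall>x\<in>ns_carrier X. (\<forall>\<phi>\<in>F. \<bar>\<phi> x - \<phi> a\<bar> < e) \<longrightarrow> x \<in> S"
      "finite G" "G \<subseteq> ns_dual X" "0 < d"
      "\<forall>x\<in>ns_carrier X. (\<forall>\<phi>\<in>G. \<bar>\<phi> x - \<phi> a\<bar> < d) \<longrightarrow> x \<in> T"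
      by blast
    then show ?case
      by (intro exI[of _ "F \<union> G"] exI[of _ "min e d"]) auto
  next
    case (UN K)
    then obtain k where "k \<in> K" "a \<in> k" by blast
    with UN.IH[OF this] show ?case by (meson UnionI)
  next
    case (Basis s)
    then obtain \<phi> U where *: "s = {x \<in> ns_carrier X. \<phi> x \<in> U}" "\<phi> \<in> ns_dual X" "open U" by blast
    with Basis obtain e where "e > 0" "\<And>z. dist z (\<phi> a) < e \<Longrightarrow> z \<in> U"
      by (auto simp: open_dist)
    with * show ?case by (intro exI[of _ "{\<phi>}"] exI[of _ e]) (auto simp: dist_real_def)
  qed simp
  then obtain F e where "finite F" "F \<subseteq> ns_dual X" "0 < e"
    "\<forall>x\<in>ns_carrier X. (\<forall>\<phi>\<in>F. \<bar>\<phi> x - \<phi> a\<bar> < e) \<longrightarrow> x \<in> T"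
    using assms(2) T(2) by blast
  with T(2) show thesis by (intro that[of F e]) auto
qed

lemma ns_weak_basic_open:
  assumes "\<And>i. \<phi> i \<in> ns_dual X" "\<And>i. open (U i)"
  shows "openin (ns_weak X) {x \<in> ns_carrier X. \<forall>i<(n::nat). \<phi> i x \<in> U i}"
proof -
  let ?S = "{{x \<in> ns_carrier X. \<phi> x \<in> U} | \<phi> U. \<phi> \<in> ns_dual X \<and> open U}"
  have basic: "openin (ns_weak X) {x \<in> ns_carrier X. \<psi> x \<in> A}" if "\<psi> \<in> ns_dual X" "open A" for \<psi> A
  proof -
    have "openin (topology_generated_by ?S) {x \<in> ns_carrier X. \<psi> x \<in> A}"
      using that by (intro topology_generated_by_Basis) blast
    then show ?thesis
      unfolding ns_weak_def openin_subtopology by (intro exI[of _ "{x \<in> ns_carrier X. \<psi> x \<in> A}"]) auto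
  qed
  show ?thesis
  proof (induction n)
    case 0
    show ?case using basic[OF assms(1), of UNIV] by simp
  next
    case (Suc n)
    have "{x \<in> ns_carrier X. \<forall>i<Suc n. \<phi> i x \<in> U i} =
      {x \<in> ns_carrier X. \<forall>i<n. \<phi> i x \<in> U i} \<inter> {x \<in> ns_carrier X. \<phi> n x \<in> U n}"
      by (auto simp: less_Suc_eq)
    then show ?case using Suc basic[OF assms] by (simp only: openin_Int)
  qed
qed

text \<open>All inequalities are strict so that failure becomes a closed condition on \<mu> and
  \<open>f\<close>. The index \<open>k\<close> is the tolerance both for the distance and for the
  functionals, and only the first \<open>n\<close> functionals are tested.\<close>

definition D2P_test :: "(V \<Rightarrow> real) \<Rightarrow> V \<Rightarrow> nat \<Rightarrow> nat \<Rightarrow> (nat \<Rightarrow> V \<Rightarrow> real) \<Rightarrow> bool" where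
  "D2P_test \<mu> x\<^sub>0 n k f \<longleftrightarrow> (\<exists>x y. \<mu> x < 1 \<and> \<mu> y < 1 \<and> \<mu> (x - y) > 2 - 1 / Suc k \<and>
     (\<forall>i<n. \<bar>f i (x - x\<^sub>0)\<bar> < 1 / Suc k \<and> \<bar>f i (y - x\<^sub>0)\<bar> < 1 / Suc k))"

context seminorm_code
begin

text \<open>The extended functionals cut out a weak neighbourhood of \<open>J x\<^sub>0\<close> in
  the ball. Two of its points almost 2 apart are replaced by rational vectors.\<close>

lemma D2P_imp_test:
  assumes D: "D2P X" and x0: "\<mu> x\<^sub>0 < 1" and f: "\<And>i. f i \<in> dual_ballV \<mu>"
  shows "D2P_test \<mu> x\<^sub>0 n k f"
proof -
  have "\<exists>\<phi>. \<phi> \<in> ns_dual X \<and> (\<forall>v. \<phi> (J v) = f i v) \<and> (\<forall>A\<in>ns_carrier X. \<bar>\<phi> A\<bar> \<le> \<nu> A)" for i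
    by (rule dual_extension[OF f[of i]]) blast
  then obtain \<phi> where \<phi>: "\<And>i. \<phi> i \<in> ns_dual X" "\<And>i v. \<phi> i (J v) = f i v"
    "\<And>i A. A \<in> ns_carrier X \<Longrightarrow> \<bar>\<phi> i A\<bar> \<le> \<nu> A"
    by metis
  have \<phi>_diff: "\<phi> i (ns_diff X A B) = \<phi> i A - \<phi> i B" if "A \<in> ns_carrier X" "B \<in> ns_carrier X" for A B i
    using \<phi>(1)[of i] that carrier_closed(2)[OF that(2,2)]
    unfolding ns_dual_def ns_diff_def by simp
  define d :: real where "d = 1 / Suc k"
  have "d > 0" by (simp add: d_def)
  \<comment> \<open>The tolerance \<open>d\<close> is shared out: \<open>d / 2\<close> for the
    neighbourhood and for the loss in the diameter, \<open>d / 4\<close> for each rational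
    approximation made below.\<close>
  define W where "W = {A \<in> ns_carrier X. \<forall>i<n. \<phi> i A \<in> ball (f i x\<^sub>0) (d / 2)} \<inter> ns_ball X"
  have "openin (subtopology (ns_weak X) (ns_ball X)) W"
    unfolding W_def openin_subtopology
    by (rule exI[of _ "{A \<in> ns_carrier X. \<forall>i<n. \<phi> i A \<in> ball (f i x\<^sub>0) (d / 2)}"])
      (intro conjI refl ns_weak_basic_open \<phi>(1) open_ball)
  moreover have "J x\<^sub>0 \<in> W"
    using x0 \<open>d > 0\<close> by (simp add: W_def ns_ball_def J_carrier norm_J \<phi>(2))
  ultimately have "ns_diam X W = 2" using D unfolding D2P_def by blast
  then have "2 - d / 2 < Sup {\<nu> (ns_diff X x y) | x y. x \<in> W \<and> y \<in> W}"
    using \<open>d > 0\<close> by (simp add: ns_diam_def)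
  then obtain A B where AB: "A \<in> W" "B \<in> W" "2 - d / 2 < \<nu> (ns_diff X A B)"
    using \<open>J x\<^sub>0 \<in> W\<close> by (elim less_cSupE) auto
  then have AB': "A \<in> ns_ball X" "B \<in> ns_ball X" "A \<in> ns_carrier X" "B \<in> ns_carrier X"
    by (auto simp: W_def)
  obtain x where x: "\<mu> x < 1" "\<nu> (ns_diff X A (J x)) < d / 4"
    using ball_approx[OF AB'(1), of "d / 4"] \<open>d > 0\<close> by auto
  obtain y where y: "\<mu> y < 1" "\<nu> (ns_diff X B (J y)) < d / 4"
    using ball_approx[OF AB'(2), of "d / 4"] \<open>d > 0\<close> by auto
  have "\<nu> (ns_diff X A B) \<le> \<nu> (ns_diff X A (J x)) + (\<nu> (ns_diff X (J x) (J y)) + \<nu> (ns_diff X (J y) B))"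
    using norm_diff_triangle[OF AB'(3) J_carrier AB'(4), of x]
      norm_diff_triangle[OF J_carrier J_carrier AB'(4), of x y] by simp
  then have "\<mu> (x - y) > 2 - d"
    using AB(3) x(2) y(2) norm_diff_commute[OF AB'(4) J_carrier, of y] by (simp add: J_diff norm_J)
  moreover have "\<bar>f i (z - x\<^sub>0)\<bar> < d" if "i < n" "C \<in> W" "\<nu> (ns_diff X C (J z)) < d / 4" for i z C
  proof -
    have C: "C \<in> ns_carrier X" "\<bar>f i x\<^sub>0 - \<phi> i C\<bar> < d / 2"
      using that by (auto simp: W_def dist_real_def)
    have "\<bar>\<phi> i C - f i z\<bar> < d / 4"
      using \<phi>(3)[OF carrier_closed(3)[OF C(1) J_carrier], of i z] \<phi>_diff[OF C(1) J_carrier, of i z] that(3)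
      by (simp add: \<phi>(2))
    with C(2) show ?thesis using dual_ballV_D(4)[OF f, of i z x\<^sub>0] by linarith
  qed
  ultimately show ?thesis
    unfolding D2P_test_def d_def[symmetric] using x y AB by blast
qed

text \<open>A weakly open set around \<open>A\<close> contains every rational vector of the open
  ball that finitely many functionals hardly separate from \<open>A\<close>, and the test supplies
  two of them almost 2 apart. The diameter is at most 2 by the triangle inequality.\<close>

lemma test_imp_D2P:
  assumes test: "\<And>x\<^sub>0 n k f. \<mu> x\<^sub>0 < 1 \<Longrightarrow> (\<And>i. f i \<in> dual_ballV \<mu>) \<Longrightarrow> D2P_test \<mu> x\<^sub>0 n k f"
  shows "D2P X"
  unfolding D2P_def
proof (intro allI impI, elim conjE)
  fix W assume W: "openin (subtopology (ns_weak X) (ns_ball X)) W" "W \<noteq> {}"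
  obtain T where T: "openin (ns_weak X) T" "W = T \<inter> ns_ball X"
    using W(1) by (auto simp: openin_subtopology)
  obtain A where A: "A \<in> W" using W(2) by blast
  then have A': "A \<in> T" "A \<in> ns_ball X" "A \<in> ns_carrier X" using T(2) by (auto simp: ns_ball_def)
  obtain F e where F: "finite F" "F \<subseteq> ns_dual X" "0 < e"
    "\<forall>x\<in>ns_carrier X. (\<forall>\<phi>\<in>F. \<bar>\<phi> x - \<phi> A\<bar> < e) \<longrightarrow> x \<in> T"
    by (rule ns_weak_openE[OF T(1) A'(1)])
  have "\<exists>C. \<forall>x\<in>ns_carrier X. \<bar>\<phi> x\<bar> \<le> C * \<nu> x" if "\<phi> \<in> F" for \<phi>
    using F(2) that by (auto simp: ns_dual_def)
  then obtain c where c: "\<And>\<phi> x. \<phi> \<in> F \<Longrightarrow> x \<in> ns_carrier X \<Longrightarrow> \<bar>\<phi> x\<bar> \<le> c \<phi> * \<nu> x"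
    by metis
  \<comment> \<open>A common bound for the norms of the functionals in \<open>F\<close>, made
    positive so that dividing by it puts them into the dual ball.\<close>
  define C where "C = 1 + (\<Sum>\<phi>\<in>F. \<bar>c \<phi>\<bar>)"
  have "C > 0" unfolding C_def by (rule add_pos_nonneg) (auto intro: sum_nonneg)
  have C: "\<bar>\<phi> x\<bar> \<le> C * \<nu> x" if "\<phi> \<in> F" "x \<in> ns_carrier X" for \<phi> x
  proof -
    have "\<bar>c \<phi>\<bar> \<le> (\<Sum>\<phi>\<in>F. \<bar>c \<phi>\<bar>)" using that(1) F(1) by (intro member_le_sum) auto
    then have "c \<phi> * \<nu> x \<le> C * \<nu> x"
      unfolding C_def by (intro mult_right_mono norm_nonneg that) linarith
    with c[OF that] show ?thesis by simp
  qed
  have lin: "\<phi> (ns_add X B D) = \<phi> B + \<phi> D" "\<phi> (ns_scale X r B) = r * \<phi> B"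
    "\<phi> (ns_diff X B D) = \<phi> B - \<phi> D"
    if "\<phi> \<in> F" "B \<in> ns_carrier X" "D \<in> ns_carrier X" for \<phi> B D r
    using F(2) that carrier_closed(2)[OF that(3,3)]
    unfolding ns_dual_def ns_diff_def by auto
  obtain n g where g: "F = g ` {i::nat. i < n}" using finite_imp_nat_seg_image_inj_on[OF F(1)] by blast
  \<comment> \<open>The test takes an infinite sequence of functionals, so the finite list is padded
    with zero.\<close>
  define f where "f i v = (if i < n then g i (J v) / C else 0)" for i v
  have f: "f i \<in> dual_ballV \<mu>" for i
  proof (cases "i < n")
    case True
    then have gi: "g i \<in> F" using g by blast
    have "\<bar>g i (J v) / C\<bar> \<le> \<mu> v" for v
      using C[OF gi J_carrier, of v] \<open>C > 0\<close> by (simp add: norm_J field_simps)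
    then show ?thesis
      using lin(1,2)[OF gi J_carrier J_carrier] True \<open>C > 0\<close>
      unfolding dual_ballV_def f_def by (simp add: add_divide_distrib flip: J_add J_scale)
  next
    case False
    then show ?thesis using seminormsVD(1)[OF code] by (simp add: dual_ballV_def f_def)
  qed
  \<comment> \<open>After multiplication by \<open>C\<close>, replacing \<open>A\<close> by
    \<open>J x0\<close> and moving from \<open>x0\<close> to \<open>x\<close> each cost less than
    \<open>e / 2\<close>.\<close>
  obtain x0 where x0: "\<mu> x0 < 1" "\<nu> (ns_diff X A (J x0)) < e / (2 * C)"
    using ball_approx[OF A'(2), of "e / (2 * C)"] F(3) \<open>C > 0\<close> by auto
  have in_W: "J x \<in> W"
    if "\<mu> x < 1" and close: "\<And>i. i < n \<Longrightarrow> \<bar>f i (x - x0)\<bar> < e / (2 * C)" for x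
  proof -
    have "\<bar>\<phi> (J x) - \<phi> A\<bar> < e" if "\<phi> \<in> F" for \<phi>
    proof -
      obtain i where i: "i < n" "\<phi> = g i" using \<open>\<phi> \<in> F\<close> g by blast
      have "\<phi> (J x) - \<phi> (J x0) = C * f i (x - x0)"
        using i \<open>C > 0\<close> lin(3)[OF that J_carrier J_carrier, of x x0]
        by (simp add: f_def flip: J_diff)
      then have "\<bar>\<phi> (J x) - \<phi> (J x0)\<bar> = C * \<bar>f i (x - x0)\<bar>"
        using \<open>C > 0\<close> by (simp add: abs_mult)
      also have "\<dots> < e / 2" using close[OF i(1)] \<open>C > 0\<close> by (simp add: field_simps)
      finally have 1: "\<bar>\<phi> (J x) - \<phi> (J x0)\<bar> < e / 2" .
      have "\<bar>\<phi> A - \<phi> (J x0)\<bar> \<le> C * \<nu> (ns_diff X A (J x0))"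
        using C[OF that carrier_closed(3)[OF A'(3) J_carrier], of x0] lin(3)[OF that A'(3) J_carrier, of x0]
        by simp
      also have "\<dots> < e / 2" using x0(2) \<open>C > 0\<close> by (simp add: field_simps)
      finally show ?thesis using 1 by linarith
    qed
    then have "J x \<in> T" using F(4) J_carrier by blast
    with \<open>\<mu> x < 1\<close> show ?thesis by (simp add: T(2) ns_ball_def J_carrier norm_J)
  qed
  show "ns_diam X W = 2"
    unfolding ns_diam_def
  proof (rule cSup_eq_non_empty)
    show "{\<nu> (ns_diff X x y) |x y. x \<in> W \<and> y \<in> W} \<noteq> {}" using A by blast
    show "r \<le> 2" if r: "r \<in> {\<nu> (ns_diff X x y) |x y. x \<in> W \<and> y \<in> W}" for r
    proof -
      obtain B D where "r = \<nu> (ns_diff X B D)" "B \<in> ns_ball X" "D \<in> ns_ball X"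
        using r T(2) by blast
      then show ?thesis using norm_diff_le(1)[of B D] by (simp add: ns_ball_def)
    qed
    fix b assume b: "\<And>r. r \<in> {\<nu> (ns_diff X x y) |x y. x \<in> W \<and> y \<in> W} \<Longrightarrow> r \<le> b"
    show "2 \<le> b"
    proof (rule ccontr)
      assume "\<not> 2 \<le> b"
      then have "min (e / (2 * C)) (2 - b) > 0" using F(3) \<open>C > 0\<close> by simp
      \<comment> \<open>This one index keeps both test points inside \<open>W\<close> and pushes
        their distance above the supposed bound \<open>b\<close>.\<close>
      then obtain k where k: "1 / real (Suc k) < min (e / (2 * C)) (2 - b)"
        using nat_approx_posE by metis
      have "D2P_test \<mu> x0 n k f" by (rule test[OF x0(1) f])
      then obtain x y where xy: "\<mu> x < 1" "\<mu> y < 1" "\<mu> (x - y) > 2 - 1 / Suc k"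
        "\<And>i. i < n \<Longrightarrow> \<bar>f i (x - x0)\<bar> < 1 / Suc k" "\<And>i. i < n \<Longrightarrow> \<bar>f i (y - x0)\<bar> < 1 / Suc k"
        unfolding D2P_test_def by blast
      have "J x \<in> W" "J y \<in> W"
        using xy k by (auto intro!: in_W intro: less_trans)
      then have "\<nu> (ns_diff X (J x) (J y)) \<le> b" using b by blast
      with xy(3) k show False by (simp add: J_diff norm_J)
    qed
  qed
qed

lemma D2P_iff_test:
  "D2P X \<longleftrightarrow> (\<forall>x\<^sub>0 n k f. \<mu> x\<^sub>0 < 1 \<longrightarrow> (\<forall>i. f i \<in> dual_ballV \<mu>) \<longrightarrow> D2P_test \<mu> x\<^sub>0 n k f)"
  using D2P_imp_test test_imp_D2P by blast

end

subsection \<open>The class is a \<open>G\<^sub>\<delta>\<close> set\<close>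

text \<open>A vector is determined by the finite graph of its nonzero coordinates.\<close>

lemma countable_UNIV_V: "countable (UNIV :: V set)"
proof -
  let ?g = "\<lambda>x :: V. (\<lambda>i. (i, lookup x i)) ` keys x"
  have "inj ?g"
  proof (rule injI, rule poly_mapping_eqI)
    fix x y :: V and i
    assume eq: "?g x = ?g y"
    have mem: "(i, lookup z i) \<in> ?g z" if "lookup z i \<noteq> 0" for z :: V
      using that by (auto simp: in_keys_iff)
    have "lookup x i = lookup y i" if "lookup x i \<noteq> 0 \<or> lookup y i \<noteq> 0"
      using that mem[of x] mem[of y] eq by auto
    then show "lookup x i = lookup y i" by force
  qed
  moreover have "countable (range ?g)"
    by (rule countable_subset[OF _ countable_Collect_finite]) auto
  ultimately show ?thesis by (metis countable_image_inj_on)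
qed

text \<open>Writing a functional of norm at most one as \<open>f i v = \<mu> v * g (i, v)\<close> lets \<open>g\<close> range over a
  compact space that does not depend on \<open>\<mu>\<close>.\<close>

definition test_failures :: "V \<Rightarrow> nat \<Rightarrow> nat \<Rightarrow> ((V \<Rightarrow> real) \<times> (nat \<times> V \<Rightarrow> real)) set" where
  "test_failures x\<^sub>0 n k = {(\<mu>, g).
     (\<forall>i u v. \<mu> (u + v) * g (i, u + v) = \<mu> u * g (i, u) + \<mu> v * g (i, v)) \<and>
     (\<forall>i q v. \<mu> (vscale q v) * g (i, vscale q v) = of_rat q * (\<mu> v * g (i, v))) \<and>
     (\<forall>x y. 1 \<le> \<mu> x \<or> 1 \<le> \<mu> y \<or> \<mu> (x - y) \<le> 2 - 1 / Suc k \<or>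
       (\<exists>i\<in>{..<n}. 1 / Suc k \<le> \<bar>\<mu> (x - x\<^sub>0) * g (i, x - x\<^sub>0)\<bar> \<or> 1 / Suc k \<le> \<bar>\<mu> (y - x\<^sub>0) * g (i, y - x\<^sub>0)\<bar>))}"

lemma closed_Collect_bex_finite:
  assumes "finite I" "\<And>i. i \<in> I \<Longrightarrow> closed {x. P i x}"
  shows "closed {x. \<exists>i\<in>I. P i x}"
proof -
  have "{x. \<exists>i\<in>I. P i x} = (\<Union>i\<in>I. {x. P i x})" by auto
  then show ?thesis using assms by (simp add: closed_UN)
qed

lemma closed_test_failures: "closed (test_failures x\<^sub>0 n k)"
proof -
  have fst: "continuous_on UNIV (\<lambda>p :: (V \<Rightarrow> real) \<times> (nat \<times> V \<Rightarrow> real). fst p v)" for v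
    by (rule continuous_on_product_then_coordinatewise[OF continuous_on_fst[OF continuous_on_id]])
  have snd: "continuous_on UNIV (\<lambda>p :: (V \<Rightarrow> real) \<times> (nat \<times> V \<Rightarrow> real). snd p j)" for j
    by (rule continuous_on_product_then_coordinatewise[OF continuous_on_snd[OF continuous_on_id]])
  show ?thesis
    unfolding test_failures_def case_prod_beta
    by (intro closed_Collect_conj closed_Collect_all closed_Collect_disj closed_Collect_eq
        closed_Collect_le closed_Collect_bex_finite continuous_on_const continuous_on_add
        continuous_on_mult continuous_on_rabs fst snd finite_lessThan)
qed

definition test_failing_codes :: "V \<Rightarrow> nat \<Rightarrow> nat \<Rightarrow> (V \<Rightarrow> real) set" where
  "test_failing_codes x\<^sub>0 n k = fst ` (test_failures x\<^sub>0 n k \<inter> UNIV \<times> (UNIV \<rightarrow>\<^sub>E {-1..1}))"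

text \<open>The functions \<open>g\<close> range over a cube, compact by Tychonoff, and projection
  along a compact factor is a closed map.\<close>

lemma closed_test_failing_codes: "closed (test_failing_codes x\<^sub>0 n k)"
proof -
  let ?K = "UNIV \<rightarrow>\<^sub>E {-1..1} :: (nat \<times> V \<Rightarrow> real) set"
  have "compactin (product_topology (\<lambda>_. euclidean) UNIV) ?K"
    by (subst compactin_PiE) simp
  then have "compact_space (top_of_set ?K)"
    by (simp add: euclidean_product_topology compact_space_subtopology)
  then have "closed_map (prod_topology euclidean (top_of_set ?K)) (euclidean :: (V \<Rightarrow> real) topology) fst"
    by (rule Abstract_Topological_Spaces.closed_map_fst)
  moreover have "closedin (prod_topology euclidean (top_of_set ?K)) (test_failures x\<^sub>0 n k \<inter> UNIV \<times> ?K)"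
    using closed_test_failures[of x\<^sub>0 n k]
    by (auto simp: prod_topology_subtopology(2) closedin_subtopology)
  ultimately show ?thesis
    by (simp add: closed_map_def test_failing_codes_def)
qed

lemma test_failing_codes_iff:
  assumes "\<mu> \<in> seminormsV"
  shows "\<mu> \<in> test_failing_codes x\<^sub>0 n k \<longleftrightarrow> (\<exists>f. (\<forall>i. f i \<in> dual_ballV \<mu>) \<and> \<not> D2P_test \<mu> x\<^sub>0 n k f)"
proof
  assume "\<mu> \<in> test_failing_codes x\<^sub>0 n k"
  then obtain g where g: "(\<mu>, g) \<in> test_failures x\<^sub>0 n k" "g \<in> UNIV \<rightarrow>\<^sub>E {-1..1}"
    by (auto simp: test_failing_codes_def)
  have "\<bar>g j\<bar> \<le> 1" for j using PiE_mem[OF g(2), of j] by auto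
  then have "\<bar>\<mu> v * g (i, v)\<bar> \<le> \<mu> v" for i v
    using seminormsVD(1)[OF assms, of v] by (simp add: abs_mult mult_left_le)
  then have "(\<lambda>v. \<mu> v * g (i, v)) \<in> dual_ballV \<mu>" for i
    using g(1) by (simp add: dual_ballV_def test_failures_def)
  moreover have "\<not> D2P_test \<mu> x\<^sub>0 n k (\<lambda>i v. \<mu> v * g (i, v))"
    using g(1) unfolding D2P_test_def test_failures_def mem_Collect_eq case_prod_conv
    by (meson lessThan_iff not_le)
  ultimately show "\<exists>f. (\<forall>i. f i \<in> dual_ballV \<mu>) \<and> \<not> D2P_test \<mu> x\<^sub>0 n k f"
    by (intro exI[of _ "\<lambda>i v. \<mu> v * g (i, v)"] conjI allI)
next
  assume "\<exists>f. (\<forall>i. f i \<in> dual_ballV \<mu>) \<and> \<not> D2P_test \<mu> x\<^sub>0 n k f"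
  then obtain f where f: "\<And>i. f i \<in> dual_ballV \<mu>" "\<not> D2P_test \<mu> x\<^sub>0 n k f" by blast
  define g where "g = (\<lambda>(i, v). f i v / \<mu> v)"
  \<comment> \<open>Where \<open>\<mu> v = 0\<close>, domination forces \<open>f i v = 0\<close>, so
    the convention for division by zero gives the right value.\<close>
  have eq: "\<mu> v * g (i, v) = f i v" for i v
    using dual_ballV_D(3)[OF f(1), of i v] by (auto simp: g_def)
  have "g (i, v) \<in> {-1..1}" for i v
  proof -
    have "\<bar>g (i, v)\<bar> \<le> 1"
      using dual_ballV_D(3)[OF f(1), of i v] seminormsVD(1)[OF assms, of v]
      by (auto simp: g_def abs_divide divide_le_eq_1)
    then show ?thesis by auto
  qed
  then have "g \<in> UNIV \<rightarrow>\<^sub>E {-1..1}" by auto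
  moreover have "(\<mu>, g) \<in> test_failures x\<^sub>0 n k"
    unfolding test_failures_def mem_Collect_eq case_prod_conv eq
  proof (intro conjI allI)
    fix x y
    show "1 \<le> \<mu> x \<or> 1 \<le> \<mu> y \<or> \<mu> (x - y) \<le> 2 - 1 / Suc k \<or>
      (\<exists>i\<in>{..<n}. 1 / Suc k \<le> \<bar>f i (x - x\<^sub>0)\<bar> \<or> 1 / Suc k \<le> \<bar>f i (y - x\<^sub>0)\<bar>)"
      using f(2) unfolding D2P_test_def by (meson lessThan_iff not_le)
  qed (simp_all add: dual_ballV_D(1,2)[OF f(1)])
  ultimately show "\<mu> \<in> test_failing_codes x\<^sub>0 n k"
    unfolding test_failing_codes_def by (metis (no_types, lifting) IntI SigmaI UNIV_I fst_conv image_eqI)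
qed

lemma D2P_class_eq:
  "D2P_class = (\<Inter>(x\<^sub>0, n, k). codesB \<inter> {\<mu>. 1 \<le> \<mu> x\<^sub>0} \<union> codesB \<inter> - test_failing_codes x\<^sub>0 n k)"
proof -
  have "D2P (Xmu \<mu>) \<longleftrightarrow> (\<forall>x\<^sub>0 n k. 1 \<le> \<mu> x\<^sub>0 \<or> \<mu> \<notin> test_failing_codes x\<^sub>0 n k)" if "\<mu> \<in> codesB" for \<mu>
  proof -
    have \<mu>: "\<mu> \<in> seminormsV" using that by (simp add: codesB_def)
    interpret seminorm_code \<mu> by unfold_locales fact
    show ?thesis unfolding D2P_iff_test test_failing_codes_iff[OF \<mu>] by (meson not_le)
  qed
  then show ?thesis by (auto simp: D2P_class_def)
qed

text \<open>For each triple, the closed condition \<open>1 \<le> \<mu> x\<close> is a countable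
  intersection of open ones and the complement of the failing codes is open. Countability of
  \<open>V\<close> leaves only countably many triples to intersect over.\<close>

lemma gdelta_in_D2P_class: "gdelta_in Btop D2P_class"
proof -
  have opn: "openin Btop (codesB \<inter> S)" if "open S" for S
    using that by (simp add: Btop_def openin_open_Int)
  have "gdelta_in Btop (codesB \<inter> {\<mu>. 1 \<le> \<mu> x} \<union> codesB \<inter> - test_failing_codes x n k)" for x n k
  proof (rule gdelta_in_Un)
    have "open {\<mu> :: V \<Rightarrow> real. 1 - 1 / Suc j < \<mu> x}" for j
      by (intro open_Collect_less continuous_on_const continuous_on_product_coordinates)
    then have "gdelta_in Btop (\<Inter>j. codesB \<inter> {\<mu>. 1 - 1 / Suc j < \<mu> x})"
      by (intro gdelta_in_Inter) (auto intro: open_imp_gdelta_in opn)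
    moreover have "1 \<le> r \<longleftrightarrow> (\<forall>j. 1 - 1 / Suc j < r)" for r :: real
    proof
      assume *: "\<forall>j. 1 - 1 / Suc j < r"
      show "1 \<le> r"
      proof (rule ccontr)
        assume "\<not> 1 \<le> r"
        then obtain j where "1 / real (Suc j) < 1 - r" using nat_approx_posE[of "1 - r"] by auto
        with * show False by (smt (verit))
      qed
    qed (smt (verit) of_nat_0_less_iff zero_less_Suc zero_less_divide_1_iff)
    then have "codesB \<inter> {\<mu>. 1 \<le> \<mu> x} = (\<Inter>j. codesB \<inter> {\<mu>. 1 - 1 / Suc j < \<mu> x})" by auto
    ultimately show "gdelta_in Btop (codesB \<inter> {\<mu>. 1 \<le> \<mu> x})" by simp
    show "gdelta_in Btop (codesB \<inter> - test_failing_codes x n k)"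
      by (intro open_imp_gdelta_in opn open_Compl closed_test_failing_codes)
  qed
  moreover have "countable (UNIV :: (V \<times> nat \<times> nat) set)"
    using countable_SIGMA[OF countable_UNIV_V, of "\<lambda>_. UNIV :: (nat \<times> nat) set"] by simp
  ultimately show ?thesis
    unfolding D2P_class_eq by (intro gdelta_in_Inter) auto
qed

subsection \<open>Sums of \<open>\<ell>\<^sub>1\<close>-blocks\<close>

text \<open>The intervals contained in a single block. The left end may be a true index, since such
  an index belongs to the block it opens.\<close>

definition segments :: "(nat \<Rightarrow> bool) \<Rightarrow> (nat \<times> nat) set" where
  "segments a = {(i, j). i \<le> j \<and> (\<forall>k. i < k \<and> k \<le> j \<longrightarrow> \<not> a k)}"

text \<open>The true values of \<open>a\<close> cut \<open>\<nat>\<close> into consecutive blocks (each true index opens a new one), and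
  \<open>block_norm a\<close> is the norm of the \<open>c\<^sub>0\<close>-sum of the \<open>\<ell>\<^sub>1\<close>-spaces over these blocks.\<close>

definition block_norm :: "(nat \<Rightarrow> bool) \<Rightarrow> c00 \<Rightarrow> real" where
  "block_norm a x = (SUP (i, j)\<in>segments a. \<Sum>k=i..j. \<bar>lookup x k\<bar>)"

lemma segment_sum_le_block_norm:
  assumes "(i, j) \<in> segments a"
  shows "(\<Sum>k=i..j. \<bar>lookup x k\<bar>) \<le> block_norm a x"
proof -
  have "(\<Sum>k=i..j. \<bar>lookup x k\<bar>) \<le> (\<Sum>k\<in>keys x. \<bar>lookup x k\<bar>)" for i j
  proof -
    have "(\<Sum>k=i..j. \<bar>lookup x k\<bar>) = (\<Sum>k\<in>{i..j} \<inter> keys x. \<bar>lookup x k\<bar>)"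
      by (rule sum.mono_neutral_right) (auto simp: in_keys_iff)
    also have "\<dots> \<le> (\<Sum>k\<in>keys x. \<bar>lookup x k\<bar>)" by (rule sum_mono2) auto
    finally show ?thesis .
  qed
  then have "bdd_above ((\<lambda>(i, j). \<Sum>k=i..j. \<bar>lookup x k\<bar>) ` segments a)"
    by (intro bdd_aboveI2[where M = "\<Sum>k\<in>keys x. \<bar>lookup x k\<bar>"]) auto
  from cSUP_upper[OF assms this] show ?thesis by (simp add: block_norm_def)
qed

lemma singleton_segment: "(i, i) \<in> segments a"
  by (auto simp: segments_def)

lemma segment_break:
  assumes "(i, j) \<in> segments a" "a k" "i \<le> k" "k \<le> j"
  shows "k = i"
proof (rule ccontr)
  assume "k \<noteq> i"
  with assms show False by (simp add: segments_def)
qed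

lemma block_norm_le:
  assumes "\<And>i j. (i, j) \<in> segments a \<Longrightarrow> (\<Sum>k=i..j. \<bar>lookup x k\<bar>) \<le> B"
  shows "block_norm a x \<le> B"
  unfolding block_norm_def using assms singleton_segment[of 0 a] by (intro cSUP_least) auto

lemma abs_lookup_le_block_norm: "\<bar>lookup x i\<bar> \<le> block_norm a x"
  using segment_sum_le_block_norm[OF singleton_segment, where i = i] by simp

lemma is_seminorm_block_norm: "is_seminorm_c00 (block_norm a)"
  unfolding is_seminorm_c00_def
proof (intro conjI allI)
  have le: "block_norm a (cscale c x) \<le> \<bar>c\<bar> * block_norm a x" for c x
    by (rule block_norm_le)
      (use segment_sum_le_block_norm in \<open>auto simp: abs_mult mult_left_mono simp flip: sum_distrib_left\<close>)
  fix x y c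
  show "0 \<le> block_norm a x" using abs_lookup_le_block_norm[of x 0 a] by simp
  show "block_norm a (cscale c x) = \<bar>c\<bar> * block_norm a x"
  proof (cases "c = 0")
    case True
    then show ?thesis using le[of c x] abs_lookup_le_block_norm[of "cscale c x" 0 a] by simp
  next
    case False
    then have "cscale (1 / c) (cscale c x) = x" by (intro poly_mapping_eqI) simp
    with le[of "1 / c" "cscale c x"] False have "\<bar>c\<bar> * block_norm a x \<le> block_norm a (cscale c x)"
      by (simp add: field_simps)
    with le[of c x] show ?thesis by simp
  qed
  show "block_norm a (x + y) \<le> block_norm a x + block_norm a y"
  proof (rule block_norm_le)
    fix i j assume *: "(i, j) \<in> segments a"
    have "(\<Sum>k=i..j. \<bar>lookup (x + y) k\<bar>) \<le> (\<Sum>k=i..j. \<bar>lookup x k\<bar>) + (\<Sum>k=i..j. \<bar>lookup y k\<bar>)"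
      unfolding sum.distrib[symmetric] by (intro sum_mono) (simp add: lookup_add)
    with segment_sum_le_block_norm[OF *, of x] segment_sum_le_block_norm[OF *, of y]
    show "(\<Sum>k=i..j. \<bar>lookup (x + y) k\<bar>) \<le> block_norm a x + block_norm a y" by linarith
  qed
qed

text \<open>Truncating a segment at \<open>N\<close> loses nothing when \<open>x\<close> vanishes
  beyond \<open>N\<close>, so later cuts are invisible. This locality is the source of continuity of
  the reduction.\<close>

lemma block_norm_cong:
  assumes "keys x \<subseteq> {..N}" "\<And>k. k \<le> N \<Longrightarrow> a k = b k"
  shows "block_norm a x = block_norm b x"
proof -
  have "block_norm a x \<le> block_norm b x" if "\<And>k. k \<le> N \<Longrightarrow> a k = b k" for a b
  proof (rule block_norm_le)
    fix i j assume *: "(i, j) \<in> segments a"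
    have out: "lookup x k = 0" if "k > N" for k
      using assms(1) that by (meson atMost_iff in_keys_iff leD subsetD)
    show "(\<Sum>k=i..j. \<bar>lookup x k\<bar>) \<le> block_norm b x"
    proof (cases "i \<le> N")
      case True
      with * that have "(i, min j N) \<in> segments b" by (auto simp: segments_def)
      from segment_sum_le_block_norm[OF this, of x]
      have "(\<Sum>k=i..min j N. \<bar>lookup x k\<bar>) \<le> block_norm b x" .
      moreover have "(\<Sum>k=i..j. \<bar>lookup x k\<bar>) = (\<Sum>k=i..min j N. \<bar>lookup x k\<bar>)"
        by (rule sum.mono_neutral_right) (auto intro!: out)
      ultimately show ?thesis by simp
    next
      case False
      then have "(\<Sum>k=i..j. \<bar>lookup x k\<bar>) = 0" using out by (intro sum.neutral) auto
      then show ?thesis using abs_lookup_le_block_norm[of x 0 b] by simp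
    qed
  qed
  from this[of a b] this[of b a] assms(2) show ?thesis by (simp add: antisym)
qed

section \<open>The codes given by the block norms\<close>

definition block_code :: "(nat \<Rightarrow> bool) \<Rightarrow> V \<Rightarrow> real" where
  "block_code a v = block_norm a (embV v)"

lemma block_code_seminorm: "block_code a \<in> seminormsV"
  using is_seminorm_block_norm[of a]
  by (auto simp: seminormsV_def is_seminorm_c00_def block_code_def embV_add embV_vscale)

lemma mubar_block_code: "mubar (block_code a) = block_norm a"
  by (rule mubar_eqI[OF is_seminorm_block_norm]) (simp add: block_code_def)

interpretation block: seminorm_code "block_code a" for a
  by unfold_locales (rule block_code_seminorm)

lemma block_code_codesB: "block_code a \<in> codesB"
proof -
  have "x = 0" if "mubar (block_code a) x = 0" for x
  proof (rule poly_mapping_eqI)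
    fix k show "lookup x k = lookup 0 k"
      using abs_lookup_le_block_norm[of x k a] that by (simp add: mubar_block_code)
  qed
  then show ?thesis
    using block.infdim_if_norm[of a] block_code_seminorm by (auto simp: codesB_def)
qed

lemma dual_ballV_zero: "f \<in> dual_ballV \<mu> \<Longrightarrow> f 0 = 0"
  using dual_ballV_D(2)[of f \<mu> 0 0] by (simp add: vscale_zero)

lemma dual_ballV_sum: "f \<in> dual_ballV \<mu> \<Longrightarrow> f (sum g I) = (\<Sum>i\<in>I. f (g i))"
  by (induction I rule: infinite_finite_induct) (simp_all add: dual_ballV_zero dual_ballV_D(1))

text \<open>Unit vectors at block openings span \<open>c\<^sub>0\<close> isometrically, so a functional of norm at most one
  restricts to an element of the unit ball of \<open>\<ell>\<^sub>1\<close>.\<close>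

lemma block_functional_sum_le_1:
  assumes f: "f \<in> dual_ballV (block_code a)" and T: "finite T" "\<And>b. b \<in> T \<Longrightarrow> a b"
  shows "(\<Sum>b\<in>T. \<bar>f (Poly_Mapping.single b 1)\<bar>) \<le> 1"
proof -
  \<comment> \<open>With these signs, \<open>f v\<close> is exactly the sum to be bounded.\<close>
  define s :: "nat \<Rightarrow> rat" where "s b = (if 0 \<le> f (Poly_Mapping.single b 1) then 1 else -1)" for b
  define v where "v = (\<Sum>b\<in>T. vscale (s b) (Poly_Mapping.single b 1))"
  have lookup_v: "lookup v k = (if k \<in> T then s k else 0)" for k
    using T(1) by (simp add: v_def lookup_sum lookup_single when_def if_distrib sum.delta cong: if_cong)
  have "f v = (\<Sum>b\<in>T. \<bar>f (Poly_Mapping.single b 1)\<bar>)"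
    unfolding v_def dual_ballV_sum[OF f] dual_ballV_D(2)[OF f] by (intro sum.cong) (auto simp: s_def)
  moreover have "block_code a v \<le> 1"
    unfolding block_code_def
  proof (rule block_norm_le)
    fix i j assume *: "(i, j) \<in> segments a"
    \<comment> \<open>\<open>v\<close> lives on true indices, and a segment can contain one only at
      its left end.\<close>
    have "(\<Sum>k=i..j. \<bar>lookup (embV v) k\<bar>) = (\<Sum>k\<in>{i}. \<bar>lookup (embV v) k\<bar>)"
    proof (rule sum.mono_neutral_right)
      show "\<forall>k\<in>{i..j} - {i}. \<bar>lookup (embV v) k\<bar> = 0"
        using segment_break[OF *] T(2) by (auto simp: lookup_v)
    qed (use * in \<open>auto simp: segments_def\<close>)
    also have "\<dots> \<le> 1" by (simp add: lookup_v s_def)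
    finally show "(\<Sum>k=i..j. \<bar>lookup (embV v) k\<bar>) \<le> 1" .
  qed
  ultimately show ?thesis using dual_ballV_D(3)[OF f, of v] by linarith
qed

text \<open>The witnesses are \<open>x0\<close> plus and minus \<open>r\<close> times the unit
  vector at a block opening \<open>b\<close> beyond the support of \<open>x0\<close>, where all
  given functionals are small.\<close>

lemma block_D2P_if_infinite:
  assumes inf: "infinite {n. a n}"
  shows "D2P (Xmu (block_code a))"
proof (rule block.test_imp_D2P)
  let ?\<mu> = "block_code a"
  let ?e = "\<lambda>b. Poly_Mapping.single b 1 :: V"
  fix x0 :: V and n k :: nat and f :: "nat \<Rightarrow> V \<Rightarrow> real"
  assume x0: "?\<mu> x0 < 1" and f: "\<And>i. f i \<in> dual_ballV ?\<mu>"
  define d :: real where "d = 1 / Suc k"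
  have d: "0 < d" "d \<le> 1" by (auto simp: d_def)
  obtain N where N: "\<And>i. i \<in> keys x0 \<Longrightarrow> i < N"
    using finite_nat_set_iff_bounded[of "keys x0"] by auto
  define S where "S = {b. a b} - {..<N}"
  have "infinite S" using inf by (simp add: S_def Diff_infinite_finite)
  \<comment> \<open>A counting argument: \<open>M\<close> block openings at which some functional is
    at least \<open>d\<close> would give a double sum of at least \<open>M * d\<close>, while each
    of the \<open>n\<close> functionals contributes at most 1.\<close>
  have "\<exists>b\<in>S. \<forall>i<n. \<bar>f i (?e b)\<bar> < d"
  proof (rule ccontr)
    assume "\<not> ?thesis"
    then have big: "\<And>b. b \<in> S \<Longrightarrow> \<exists>i<n. d \<le> \<bar>f i (?e b)\<bar>" by (meson not_le)
    obtain M :: nat where M: "real n / d < M" using reals_Archimedean2 by blast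
    obtain T where T: "finite T" "card T = M" "T \<subseteq> S"
      using infinite_arbitrarily_large[OF \<open>infinite S\<close>] by blast
    have "real M * d = (\<Sum>b\<in>T. d)" using T by simp
    also have "\<dots> \<le> (\<Sum>b\<in>T. \<Sum>i<n. \<bar>f i (?e b)\<bar>)"
    proof (rule sum_mono)
      fix b assume "b \<in> T"
      then obtain i where i: "i < n" "d \<le> \<bar>f i (?e b)\<bar>" using big T(3) by blast
      have "\<bar>f i (?e b)\<bar> \<le> (\<Sum>i<n. \<bar>f i (?e b)\<bar>)"
        using i(1) by (intro member_le_sum) auto
      with i(2) show "d \<le> (\<Sum>i<n. \<bar>f i (?e b)\<bar>)" by linarith
    qed
    also have "\<dots> = (\<Sum>i<n. \<Sum>b\<in>T. \<bar>f i (?e b)\<bar>)" by (rule sum.swap)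
    also have "\<dots> \<le> (\<Sum>i<n. 1)"
      using T by (intro sum_mono block_functional_sum_le_1[OF f]) (auto simp: S_def)
    finally have "real M * d \<le> n" by simp
    with M d show False by (simp add: field_simps)
  qed
  then obtain b where "b \<in> S" and b_small: "\<forall>i<n. \<bar>f i (?e b)\<bar> < d" by blast
  then have b: "a b" "N \<le> b" by (auto simp: S_def)
  obtain r where r: "1 - d / 2 < real_of_rat r" "real_of_rat r < 1"
    using of_rat_dense[of "1 - d / 2" 1] d by auto
  have lookup_x0: "lookup x0 k = 0" if "b \<le> k" for k
    using N[of k] b(2) that by (force simp: in_keys_iff)
  have close: "?\<mu> (x0 + vscale q (?e b)) < 1 \<and> (\<forall>i<n. \<bar>f i (x0 + vscale q (?e b) - x0)\<bar> < d)"
    if q: "\<bar>real_of_rat q\<bar> < 1" for q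
  proof (intro conjI allI impI)
    let ?x = "embV (x0 + vscale q (?e b))"
    have look: "lookup ?x k = of_rat (lookup x0 k) + (if k = b then of_rat q else 0)" for k
      by (simp add: lookup_add lookup_single when_def of_rat_add)
    \<comment> \<open>A segment meeting \<open>b\<close> starts there, and \<open>x0\<close>
      vanishes from \<open>b\<close> on; all other segments see only \<open>x0\<close>.\<close>
    have "?\<mu> (x0 + vscale q (?e b)) \<le> max (?\<mu> x0) \<bar>real_of_rat q\<bar>"
      unfolding block_code_def
    proof (rule block_norm_le)
      fix i j assume *: "(i, j) \<in> segments a"
      show "(\<Sum>k=i..j. \<bar>lookup ?x k\<bar>) \<le> max (block_norm a (embV x0)) \<bar>real_of_rat q\<bar>"
      proof (cases "b \<in> {i..j}")
        case True
        then have "i = b" using segment_break[OF * b(1)] by simp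
        have "(\<Sum>k=i..j. \<bar>lookup ?x k\<bar>) = (\<Sum>k\<in>{b}. \<bar>lookup ?x k\<bar>)"
          by (rule sum.mono_neutral_right) (use True \<open>i = b\<close> in \<open>auto simp: look lookup_x0 simp del: lookup_embV\<close>)
        also have "\<dots> = \<bar>real_of_rat q\<bar>" by (simp add: look lookup_x0 del: lookup_embV)
        finally show ?thesis by simp
      next
        case False
        then have "(\<Sum>k=i..j. \<bar>lookup ?x k\<bar>) = (\<Sum>k=i..j. \<bar>lookup (embV x0) k\<bar>)"
          by (intro sum.cong refl) (auto simp: look simp del: lookup_embV, auto)
        with segment_sum_le_block_norm[OF *, of "embV x0"] show ?thesis by simp
      qed
    qed
    with x0 q show "?\<mu> (x0 + vscale q (?e b)) < 1" by linarith
    fix i assume "i < n"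
    have "\<bar>real_of_rat q * f i (?e b)\<bar> \<le> \<bar>f i (?e b)\<bar>"
      using q by (simp add: abs_mult mult_left_le_one_le)
    with b_small \<open>i < n\<close> show "\<bar>f i (x0 + vscale q (?e b) - x0)\<bar> < d"
      by (auto simp: dual_ballV_D(2)[OF f])
  qed
  have "(x0 + vscale r (?e b)) - (x0 + vscale (- r) (?e b)) = vscale (2 * r) (?e b)"
    by (rule poly_mapping_eqI) (simp add: lookup_add lookup_minus)
  moreover have "?\<mu> (vscale (2 * r) (?e b)) \<ge> 2 * real_of_rat r"
    using abs_lookup_le_block_norm[of "embV (vscale (2 * r) (?e b))" b a]
    by (simp add: block_code_def of_rat_mult)
  ultimately have "?\<mu> ((x0 + vscale r (?e b)) - (x0 + vscale (- r) (?e b))) > 2 - d"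
    using r(1) by simp
  moreover have "\<bar>real_of_rat r\<bar> < 1" "\<bar>real_of_rat (- r)\<bar> < 1"
    unfolding of_rat_minus using r d by linarith+
  ultimately show "D2P_test ?\<mu> x0 n k f"
    unfolding D2P_test_def d_def[symmetric] using close[of r] close[of "- r"] by blast
qed

text \<open>If \<open>a\<close> has no true index beyond \<open>N\<close>, a small weak neighbourhood of \<open>(1 - d) e\<^sub>N\<close> fixes the
  coordinates up to \<open>N\<close>, and the last block leaves at most \<open>2 d\<close> of norm for the others.\<close>

lemma block_not_D2P_if_finite:
  assumes fin: "finite {n. a n}"
  shows "\<not> D2P (Xmu (block_code a))"
proof
  let ?\<mu> = "block_code a"
  assume D: "D2P (Xmu ?\<mu>)"
  obtain N where N: "\<And>k. k > N \<Longrightarrow> \<not> a k"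
    using fin finite_nat_set_iff_bounded[of "{n. a n}"] by (metis mem_Collect_eq not_less_iff_gr_or_eq)
  \<comment> \<open>The distance of the two test points will be at most \<open>2 * N * d\<close>
    from the coordinates below \<open>N\<close>, \<open>2 * d\<close> from coordinate
    \<open>N\<close> and \<open>4 * d\<close> from the tails. This choice makes the total 1, against
    the required \<open>2 - d\<close>.\<close>
  define K where "K = 2 * N + 5"
  define q :: rat where "q = 1 / of_nat (Suc K)"
  define d :: real where "d = 1 / Suc K"
  have dq: "real_of_rat q = d" by (simp add: q_def d_def of_rat_divide of_rat_add)
  have d: "0 < d" "d \<le> 1" "(2 * N + 6) * d = 1" by (auto simp: d_def K_def field_simps)
  define x0 :: V where "x0 = vscale (1 - q) (Poly_Mapping.single N 1)"
  have look0: "real_of_rat (lookup x0 k) = (if k = N then 1 - d else 0)" for k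
    by (auto simp: x0_def lookup_single when_def of_rat_diff dq)
  \<comment> \<open>The test is applied to the coordinate functionals at 0 up to
    \<open>N\<close>.\<close>
  define f :: "nat \<Rightarrow> V \<Rightarrow> real" where "f i v = of_rat (lookup v i)" for i v
  have f: "f i \<in> dual_ballV ?\<mu>" for i
    using abs_lookup_le_block_norm[of "embV _" i a]
    by (auto simp: dual_ballV_def f_def lookup_add of_rat_add of_rat_mult block_code_def)
  have "?\<mu> x0 \<le> 1 - d"
    unfolding block_code_def
  proof (rule block_norm_le)
    fix i j
    have "(\<Sum>k=i..j. \<bar>lookup (embV x0) k\<bar>) = (\<Sum>k=i..j. if k = N then 1 - d else 0)"
      using d by (intro sum.cong) (auto simp: look0)
    also have "\<dots> \<le> 1 - d" using d by (simp add: sum.delta)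
    finally show "(\<Sum>k=i..j. \<bar>lookup (embV x0) k\<bar>) \<le> 1 - d" .
  qed
  then have "?\<mu> x0 < 1" using d by simp
  then have "D2P_test ?\<mu> x0 (Suc N) K f" by (rule block.D2P_imp_test[OF D _ f])
  then obtain x y where xy: "?\<mu> x < 1" "?\<mu> y < 1" "?\<mu> (x - y) > 2 - d"
    "\<forall>i\<le>N. \<bar>f i (x - x0)\<bar> < d" "\<forall>i\<le>N. \<bar>f i (y - x0)\<bar> < d"
    unfolding D2P_test_def d_def[symmetric] by (auto simp: less_Suc_eq_le)
  have head: "\<bar>real_of_rat (lookup z k)\<bar> < d" if "k < N" "\<forall>i\<le>N. \<bar>f i (z - x0)\<bar> < d" for z k
    using that by (auto simp: f_def lookup_minus of_rat_diff look0 dest!: spec[of _ k])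
  have mid: "\<bar>real_of_rat (lookup z N) - (1 - d)\<bar> < d" if "\<forall>i\<le>N. \<bar>f i (z - x0)\<bar> < d" for z
    using that[THEN spec, of N] by (simp add: f_def lookup_minus of_rat_diff look0)
  \<comment> \<open>From \<open>N\<close> on there are no further cuts, so the absolute values there
    sum to less than 1, of which coordinate \<open>N\<close> takes more than
    \<open>1 - 2 * d\<close>.\<close>
  have tail: "(\<Sum>k\<in>{N<..N+j}. \<bar>real_of_rat (lookup z k)\<bar>) \<le> 2 * d"
    if "?\<mu> z < 1" "\<forall>i\<le>N. \<bar>f i (z - x0)\<bar> < d" for z j
  proof -
    have "(N, N + j) \<in> segments a" using N by (auto simp: segments_def)
    from segment_sum_le_block_norm[OF this, of "embV z"] that(1)
    have "(\<Sum>k=N..N+j. \<bar>real_of_rat (lookup z k)\<bar>) < 1" by (simp add: block_code_def)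
    moreover have "{N..N+j} = insert N {N<..N+j}" by auto
    then have "(\<Sum>k=N..N+j. \<bar>real_of_rat (lookup z k)\<bar>) =
        \<bar>real_of_rat (lookup z N)\<bar> + (\<Sum>k\<in>{N<..N+j}. \<bar>real_of_rat (lookup z k)\<bar>)"
      by simp
    ultimately show ?thesis using mid[OF that(2)] by linarith
  qed
  have "?\<mu> (x - y) \<le> 1"
    unfolding block_code_def
  proof (rule block_norm_le)
    fix i j
    let ?g = "\<lambda>k. \<bar>real_of_rat (lookup x k) - real_of_rat (lookup y k)\<bar>"
    have "(\<Sum>k=i..j. \<bar>lookup (embV (x - y)) k\<bar>) \<le> (\<Sum>k\<in>{..<N} \<union> {N} \<union> {N<..N+j}. ?g k)"
      unfolding lookup_embV lookup_minus of_rat_diff by (intro sum_mono2) auto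
    also have "\<dots> = (\<Sum>k<N. ?g k) + ?g N + (\<Sum>k\<in>{N<..N+j}. ?g k)"
      by (subst sum.union_disjoint; (subst sum.union_disjoint)?) auto
    also have "\<dots> \<le> N * (2 * d) + 2 * d + 4 * d"
    proof (intro add_mono)
      have "?g k \<le> 2 * d" if "k \<in> {..<N}" for k
      proof -
        have "k < N" using that by simp
        from head[OF this xy(4)] head[OF this xy(5)] show ?thesis by linarith
      qed
      from sum_bounded_above[of "{..<N}" ?g, OF this] show "(\<Sum>k<N. ?g k) \<le> N * (2 * d)" by simp
      show "?g N \<le> 2 * d" using mid[OF xy(4)] mid[OF xy(5)] by linarith
      have "(\<Sum>k\<in>{N<..N+j}. ?g k) \<le> (\<Sum>k\<in>{N<..N+j}. \<bar>real_of_rat (lookup x k)\<bar> + \<bar>real_of_rat (lookup y k)\<bar>)"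
        by (rule sum_mono) linarith
      also have "\<dots> \<le> 4 * d"
        using tail[OF xy(1,4), of j] tail[OF xy(2,5), of j] by (simp add: sum.distrib)
      finally show "(\<Sum>k\<in>{N<..N+j}. ?g k) \<le> 4 * d" .
    qed
    also have "\<dots> = 1" using d(3) by (simp add: algebra_simps)
    finally show "(\<Sum>k=i..j. \<bar>lookup (embV (x - y)) k\<bar>) \<le> 1" .
  qed
  with xy(3) d show False by simp
qed

section \<open>Open and G-delta sets in terms of clopen sequences\<close>

lemma zero_dimensional_open_eq_disjoint_clopens:
  assumes Y: "metrizable_space Y" "separable_space Y" "Y dim_le 0" and U: "openin Y U"
  obtains C :: "nat \<Rightarrow> 'a set" where
    "\<And>n. openin Y (C n)" "\<And>n. closedin Y (C n)" "disjoint_family C" "(\<Union>n. C n) = U"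
proof -
  obtain M d where Md: "Metric_space M d" "Y = Metric_space.mtopology M d"
    using Y(1) by (auto simp: metrizable_space_def)
  interpret Metric_space M d by fact
  obtain D where D: "countable D" "D \<subseteq> M" "Y closure_of D = M"
    using Y(2) Md(2) by (auto simp: separable_space_def)
  define \<C> where "\<C> = {C. openin Y C \<and> closedin Y C \<and> C \<subseteq> U}"
  \<comment> \<open>A Lindelof argument: \<open>I\<close> indexes the balls with centre in
    \<open>D\<close> and radius \<open>1 / Suc n\<close> that fit into a clopen subset of
    \<open>U\<close>, and \<open>pick\<close> selects such a subset. As \<open>I\<close> is
    countable, so is the resulting cover of \<open>U\<close>.\<close>
  define pick where "pick = (\<lambda>(p, n). SOME C. C \<in> \<C> \<and> mball p (1 / Suc n) \<subseteq> C)"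
  define I where "I = {(p, n). p \<in> D \<and> (\<exists>C. C \<in> \<C> \<and> mball p (1 / Suc n) \<subseteq> C)}"
  have pick: "pick (p, n) \<in> \<C> \<and> mball p (1 / Suc n) \<subseteq> pick (p, n)" if "(p, n) \<in> I" for p n
  proof -
    have "\<exists>C. C \<in> \<C> \<and> mball p (1 / Suc n) \<subseteq> C" using that by (simp add: I_def)
    from someI_ex[OF this] show ?thesis by (simp add: pick_def)
  qed
  have "countable I"
    by (rule countable_subset[of _ "D \<times> UNIV"]) (use D(1) in \<open>auto simp: I_def\<close>)
  have cover: "\<exists>j\<in>I. y \<in> pick j" if yU: "y \<in> U" for y
  proof -
    have "\<forall>W x. openin Y W \<and> x \<in> W \<longrightarrow> (\<exists>C. (closedin Y C \<and> openin Y C) \<and> x \<in> C \<and> C \<subseteq> W)"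
      using Y(3) open_neighbourhood_base_of[of "\<lambda>C. closedin Y C \<and> openin Y C" Y]
      by (simp add: dimension_le_0_neighbourhood_base_of_clopen)
    then obtain C where C: "C \<in> \<C>" "y \<in> C"
      using U yU unfolding \<C>_def by blast
    have "openin mtopology C" using C(1) Md(2) by (simp add: \<C>_def)
    then obtain r where r: "r > 0" "mball y r \<subseteq> C" "y \<in> M"
      using C(2) unfolding openin_mtopology by blast
    \<comment> \<open>Less than half the radius, so that the ball about a dense point near
      \<open>y\<close> contains \<open>y\<close> and stays inside \<open>mball y r\<close>.\<close>
    obtain n where n: "1 / real (Suc n) < r / 2" using nat_approx_posE[of "r / 2"] r(1) by auto
    have "y \<in> mtopology closure_of D" using D(3) Md(2) r(3) by simp
    moreover have "(0::real) < 1 / Suc n" by simp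
    ultimately obtain p where p: "p \<in> D" "p \<in> mball y (1 / Suc n)"
      unfolding metric_closure_of by blast
    have "mball p (1 / Suc n) \<subseteq> mball y r"
      by (rule mball_subset) (use p n r commute[of p y] in auto)
    then have "(p, n) \<in> I" using p(1) C(1) r(2) by (auto simp: I_def)
    moreover have "y \<in> mball p (1 / Suc n)" using p(2) by (simp add: commute)
    ultimately show ?thesis using pick by blast
  qed
  define B where "B n = (if I = {} then {} else pick (from_nat_into I n))" for n
  have B: "B n \<in> \<C>" for n
  proof (cases "I = {}")
    case False
    obtain p m where *: "from_nat_into I n = (p, m)" by fastforce
    with from_nat_into[OF False, of n] pick[of p m] False show ?thesis by (simp add: B_def)
  qed (simp add: B_def \<C>_def)
  have "(\<Union>n. B n) = U"
  proof
    show "(\<Union>n. B n) \<subseteq> U" using B by (auto simp: \<C>_def)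
    show "U \<subseteq> (\<Union>n. B n)"
    proof
      fix y assume "y \<in> U"
      then obtain j where j: "j \<in> I" "y \<in> pick j" using cover by blast
      then obtain n where "from_nat_into I n = j"
        using from_nat_into_surj[OF \<open>countable I\<close>] by blast
      with j show "y \<in> (\<Union>n. B n)" by (auto simp: B_def)
    qed
  qed
  moreover have "openin Y (disjointed B n)" "closedin Y (disjointed B n)" for n
    using B unfolding disjointed_def \<C>_def
    by (intro openin_diff closedin_diff closedin_Union openin_Union; force)+
  ultimately show thesis
    by (intro that[of "disjointed B"]) (simp_all add: disjoint_family_disjointed UN_disjointed_eq)
qed

text \<open>Write \<open>A\<close> as a decreasing intersection of open \<open>U n\<close>, and each
  \<open>U n\<close> as a disjoint union of clopen \<open>C n m\<close>. A point lies in at most one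
  \<open>C n m\<close> for each \<open>n\<close>, so it lies in infinitely many of them iff it lies
  in infinitely many \<open>U n\<close>, that is, in all of them.\<close>

lemma gdelta_in_iff_infinite_clopens:
  assumes Y: "metrizable_space Y" "separable_space Y" "Y dim_le 0" and A: "gdelta_in Y A"
  obtains C :: "nat \<Rightarrow> 'a set" where "\<And>n. openin Y (C n)" "\<And>n. closedin Y (C n)"
    "A = {y \<in> topspace Y. infinite {n. y \<in> C n}}"
proof -
  obtain U where U: "\<And>n. openin Y (U n)" "\<And>n. U (Suc n) \<subseteq> U n" "\<Inter>(range U) = A"
    using A unfolding gdelta_in_descending by blast
  have "\<exists>C::nat \<Rightarrow> 'a set. (\<forall>m. openin Y (C m) \<and> closedin Y (C m)) \<and> disjoint_family C \<and> (\<Union>m. C m) = U n" for n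
    by (rule zero_dimensional_open_eq_disjoint_clopens[OF Y U(1)[of n]]) blast
  then obtain C :: "nat \<Rightarrow> nat \<Rightarrow> 'a set" where C: "\<And>n m. openin Y (C n m)" "\<And>n m. closedin Y (C n m)"
    "\<And>n. disjoint_family (C n)" "\<And>n. (\<Union>m. C n m) = U n"
    by metis
  have anti: "U n \<subseteq> U m" if "m \<le> n" for m n
    using that U(2) by (rule lift_Suc_antimono_le[rotated])
  have "y \<in> A \<longleftrightarrow> infinite {p. y \<in> (\<lambda>(n, m). C n m) (prod_decode p)}" for y
  proof -
    let ?P = "{(n, m). y \<in> C n m}"
    have inj: "inj_on fst ?P"
      using C(3) by (fastforce simp: inj_on_def disjoint_family_on_def)
    have "fst ` ?P = {n. y \<in> U n}" using C(4) by force
    have "{p. y \<in> (\<lambda>(n, m). C n m) (prod_decode p)} = prod_decode -` ?P" by (auto split: prod.splits)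
    also have "finite \<dots> \<longleftrightarrow> finite ?P"
      using finite_vimage_iff[OF bij_prod_decode] by blast
    also have "\<dots> \<longleftrightarrow> finite {n. y \<in> U n}"
      using finite_image_iff[OF inj] \<open>fst ` ?P = _\<close> by simp
    also have "\<dots> \<longleftrightarrow> y \<notin> A"
    proof
      assume "finite {n. y \<in> U n}"
      then obtain N where "y \<notin> U N" using ex_new_if_finite[OF infinite_UNIV_nat] by blast
      then show "y \<notin> A" using U(3) by blast
    next
      assume "y \<notin> A"
      then obtain N where "y \<notin> U N" using U(3) by blast
      then have "{n. y \<in> U n} \<subseteq> {..<N}" using anti by (force simp: not_le[symmetric])
      then show "finite {n. y \<in> U n}" by (rule finite_subset) simp
    qed
    finally show ?thesis by blast
  qed
  moreover have "A \<subseteq> topspace Y" using A by (rule gdelta_in_subset)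
  ultimately show thesis
    using C(1,2) by (intro that[of "\<lambda>p. (\<lambda>(n, m). C n m) (prod_decode p)"]) (auto split: prod.splits)
qed

text \<open>Each coordinate of the map is locally constant: its value at \<open>v\<close> depends
  only on membership in the finitely many \<open>C n\<close> with \<open>n\<close> up to a bound for
  the support of \<open>v\<close>.\<close>

lemma continuous_map_block_code:
  assumes "\<And>n. openin Y (C n)" "\<And>n. closedin Y (C n)"
  shows "continuous_map Y Btop (\<lambda>y. block_code (\<lambda>n. y \<in> C n))"
proof -
  have "continuous_map Y euclideanreal (\<lambda>y. block_code (\<lambda>n. y \<in> C n) v)" for v
  proof -
    have "finite (keys (embV v))" by simp
    then obtain N where N: "keys (embV v) \<subseteq> {..N}" by (auto simp: finite_nat_iff_bounded_le)
    \<comment> \<open>The open set of points with the same membership pattern as \<open>y\<close> in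
      the sets \<open>C 0\<close> to \<open>C N\<close>.\<close>
    define Q where "Q y = topspace Y \<inter> (\<Inter>n\<in>{..N}. if y \<in> C n then C n else topspace Y - C n)" for y
    have Q_open: "openin Y (Q y)" for y
      unfolding Q_def using assms by (intro openin_Int_Inter) (auto intro: openin_diff)
    have Q_const: "block_code (\<lambda>n. z \<in> C n) v = block_code (\<lambda>n. y \<in> C n) v" if "z \<in> Q y" for y z
      unfolding block_code_def
      by (rule block_norm_cong[OF N]) (use that in \<open>auto simp: Q_def split: if_splits\<close>)
    have Q_self: "y \<in> Q y" if "y \<in> topspace Y" for y
      using that unfolding Q_def by auto
    show ?thesis
      unfolding continuous_map
    proof (intro conjI allI impI)
      fix U :: "real set"
      let ?g = "\<lambda>y. block_code (\<lambda>n. y \<in> C n) v"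
      have "{y \<in> topspace Y. ?g y \<in> U} = (\<Union>y\<in>{y \<in> topspace Y. ?g y \<in> U}. Q y)"
      proof (intro equalityI subsetI)
        fix z assume "z \<in> (\<Union>y\<in>{y \<in> topspace Y. ?g y \<in> U}. Q y)"
        then obtain y where y: "?g y \<in> U" "z \<in> Q y" by blast
        then have "z \<in> topspace Y" by (simp add: Q_def)
        with y Q_const[OF y(2)] show "z \<in> {y \<in> topspace Y. ?g y \<in> U}" by simp
      qed (use Q_self in blast)
      also have "openin Y \<dots>" by (rule openin_Union) (use Q_open in blast)
      finally show "openin Y {y \<in> topspace Y. ?g y \<in> U}" .
    qed simp
  qed
  then have "continuous_map Y (product_topology (\<lambda>_. euclidean) UNIV) (\<lambda>y. block_code (\<lambda>n. y \<in> C n))"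
    unfolding continuous_map_componentwise_UNIV by blast
  then show ?thesis
    unfolding Btop_def euclidean_product_topology
    by (simp add: continuous_map_in_subtopology block_code_codesB image_subset_iff)
qed

lemma block_code_D2P_class: "block_code a \<in> D2P_class \<longleftrightarrow> infinite {n. a n}"
  using block_code_codesB block_D2P_if_infinite block_not_D2P_if_finite by (auto simp: D2P_class_def)

theorem theorem4p2:
  shows "gdelta_in Btop D2P_class \<and>
    (\<forall>(Y :: 'y topology) (A :: 'y set).
       Polish_space Y \<and> Y dim_le 0 \<and> gdelta_in Y A \<longrightarrow>
       (\<exists>f. continuous_map Y Btop f \<and> A = {y \<in> topspace Y. f y \<in> D2P_class}))"
proof (intro conjI allI impI, rule gdelta_in_D2P_class, elim conjE)
  fix Y :: "'y topology" and A :: "'y set"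
  assume "Polish_space Y" "Y dim_le 0" "gdelta_in Y A"
  then have "metrizable_space Y" "separable_space Y"
    by (auto simp: Polish_space_def completely_metrizable_imp_metrizable_space)
  from gdelta_in_iff_infinite_clopens[OF this \<open>Y dim_le 0\<close> \<open>gdelta_in Y A\<close>]
  obtain C :: "nat \<Rightarrow> 'y set" where C: "\<forall>n. openin Y (C n)" "\<forall>n. closedin Y (C n)"
    "A = {y \<in> topspace Y. infinite {n. y \<in> C n}}"
    by blast
  then show "\<exists>f. continuous_map Y Btop f \<and> A = {y \<in> topspace Y. f y \<in> D2P_class}"
    using continuous_map_block_code[of Y C] block_code_D2P_class
    by (intro exI[of _ "\<lambda>y. block_code (\<lambda>n. y \<in> C n)"]) simp
qed

end
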